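(* Let $G$ be a profinite group. The following statements are equivalent: (1) the lattice $\mathcal{L}_c(G)$ is distributive; (2) the lattice $\mathcal{L}_o(G)$ is distributive; (3) $G$ is procyclic.
   Context: For a profinite group $G$: $\mathcal{L}_c(G)$ is the lattice of all closed subgroups of $G$, with meet the intersection and join $X\vee_c Y=\overline{\langle X,Y\rangle}$ (topological closure); $\mathcal{L}_o(G)$ is the lattice of all open subgroups of $G$, with meet the intersection and join $\langle X,Y\rangle$. A lattice $L$ is distributive if $x\vee(y\wedge z)=(x\vee y)\wedge(x\vee z)$ for all $x,y,z\in L$. A profinite group is procyclic if it is an inverse limit of finite cyclic groups (equivalently, it is the closure of a cyclic subgroup). *)

theory Defs
  imports "HOL-Analysis.Analysis" "HOL-Algebra.Product_Groups" "HOL-Algebra.Multiplicative_Group"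
begin

subsection \<open>Topological and profinite groups\<close>

locale topological_group = group G for G :: "('a, 'c) monoid_scheme" (structure) +
  fixes T :: "'a topology"
  assumes topspace_eq: "topspace T = carrier G"
    and continuous_mult: "continuous_map (prod_topology T T) T (\<lambda>(x, y). x \<otimes> y)"
    and continuous_inv: "continuous_map T T (\<lambda>x. inv x)"

locale profinite_group = topological_group +
  assumes compact: "compact_space T"
    and Hausdorff: "Hausdorff_space T"
    and totally_disconnected: "\<And>x. x \<in> topspace T \<Longrightarrow> connected_component_of_set T x = {x}"

definition topological_group_iso ::
    "('a, 'c) monoid_scheme \<Rightarrow> 'a topology \<Rightarrow> ('b, 'd) monoid_scheme \<Rightarrow> 'b topology \<Rightarrow> ('a \<Rightarrow> 'b) \<Rightarrow> bool" where
  "topological_group_iso G T H U h \<longleftrightarrow> h \<in> iso G H \<and> homeomorphic_map T U h"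

subsection \<open>Inverse limits of discrete groups\<close>

text \<open>An inverse system over the directed poset \<open>(I, r)\<close>, where \<open>(i, j) \<in> r\<close> means \<open>i \<le> j\<close>
  and then \<open>\<phi> i j\<close> goes from \<open>H j\<close> to \<open>H i\<close>.\<close>

locale inverse_system =
  fixes I :: "'i set" and r :: "'i rel" and H :: "'i \<Rightarrow> 'b monoid" and \<phi> :: "'i \<Rightarrow> 'i \<Rightarrow> 'b \<Rightarrow> 'b"
  assumes partial_order: "partial_order_on I r"
    and nonempty: "I \<noteq> {}"
    and directed: "\<And>i j. i \<in> I \<Longrightarrow> j \<in> I \<Longrightarrow> \<exists>k\<in>I. (i, k) \<in> r \<and> (j, k) \<in> r"
    and groups: "\<And>i. i \<in> I \<Longrightarrow> group (H i)"
    and hom: "\<And>i j. (i, j) \<in> r \<Longrightarrow> \<phi> i j \<in> hom (H j) (H i)"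
    and identity: "\<And>i x. i \<in> I \<Longrightarrow> x \<in> carrier (H i) \<Longrightarrow> \<phi> i i x = x"
    and compose: "\<And>i j k x. (i, j) \<in> r \<Longrightarrow> (j, k) \<in> r \<Longrightarrow> x \<in> carrier (H k)
      \<Longrightarrow> \<phi> i j (\<phi> j k x) = \<phi> i k x"

definition inverse_limit_carrier ::
    "'i set \<Rightarrow> 'i rel \<Rightarrow> ('i \<Rightarrow> 'b monoid) \<Rightarrow> ('i \<Rightarrow> 'i \<Rightarrow> 'b \<Rightarrow> 'b) \<Rightarrow> ('i \<Rightarrow> 'b) set" where
  "inverse_limit_carrier I r H \<phi> =
    {x \<in> (\<Pi>\<^sub>E i\<in>I. carrier (H i)). \<forall>i j. (i, j) \<in> r \<longrightarrow> \<phi> i j (x j) = x i}"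

definition inverse_limit_group ::
    "'i set \<Rightarrow> 'i rel \<Rightarrow> ('i \<Rightarrow> 'b monoid) \<Rightarrow> ('i \<Rightarrow> 'i \<Rightarrow> 'b \<Rightarrow> 'b) \<Rightarrow> ('i \<Rightarrow> 'b) monoid" where
  "inverse_limit_group I r H \<phi> =
    (product_group I H)\<lparr>carrier := inverse_limit_carrier I r H \<phi>\<rparr>"

definition inverse_limit_topology ::
    "'i set \<Rightarrow> 'i rel \<Rightarrow> ('i \<Rightarrow> 'b monoid) \<Rightarrow> ('i \<Rightarrow> 'i \<Rightarrow> 'b \<Rightarrow> 'b) \<Rightarrow> ('i \<Rightarrow> 'b) topology" where
  "inverse_limit_topology I r H \<phi> =
    subtopology (product_topology (\<lambda>i. discrete_topology (carrier (H i))) I)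
      (inverse_limit_carrier I r H \<phi>)"

subsection \<open>Procyclic groups\<close>

text \<open>HOL cannot quantify over the types of the indices and of the group elements inside a
  definition. Both are fixed to be \<open>'a set\<close>, the type of subgroups and of cosets of the
  group. This is no restriction: lemma \<open>procyclic_if_inverse_limit\<close> below shows that an inverse
  limit of finite cyclic groups over arbitrary types is procyclic in this sense.\<close>

definition procyclic :: "('a, 'c) monoid_scheme \<Rightarrow> 'a topology \<Rightarrow> bool" where
  "procyclic G T \<longleftrightarrow>
    (\<exists>(I :: 'a set set) r (H :: 'a set \<Rightarrow> 'a set monoid) \<phi> h.
      inverse_system I r H \<phi> \<and>
      (\<forall>i\<in>I. finite (carrier (H i)) \<and> cyclic_group (H i)) \<and>
      topological_group_iso G T (inverse_limit_group I r H \<phi>) (inverse_limit_topology I r H \<phi>) h)"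

lemma finite_cyclic_subgroup_cyclic:
  assumes "group K" and cyc: "cyclic_group K" and fin: "finite (carrier K)" and sub: "subgroup S K"
  shows "\<exists>s\<in>S. S = range (\<lambda>n::int. s [^]\<^bsub>K\<^esub> n)"
proof -
  interpret group K by fact
  obtain x where x: "x \<in> carrier K" and K: "carrier K = range (\<lambda>n::int. x [^]\<^bsub>K\<^esub> n)"
    using cyc cyclic_group by blast
  define P where "P = (\<lambda>d::nat. d > 0 \<and> x [^]\<^bsub>K\<^esub> d \<in> S)"
  have "P (ord x)"
    unfolding P_def using ord_ge_1[OF fin x] pow_ord_eq_1[OF x] subgroup.one_closed[OF sub] by simp
  define d where "d = (LEAST d. P d)"
  have "P d"
    unfolding d_def using \<open>P (ord x)\<close> by (rule LeastI)
  have least: "\<not> P e" if "e < d" for e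
    using that unfolding d_def by (rule not_less_Least)
  define s where "s = x [^]\<^bsub>K\<^esub> d"
  have s: "s \<in> S" and d: "d > 0"
    using \<open>P d\<close> by (auto simp: P_def s_def)
  have sc: "s \<in> carrier K" using s sub subgroup.subset by blast
  have powS: "s [^]\<^bsub>K\<^esub> n \<in> S" for n :: int
    using sub s by (simp add: subgroup_int_pow_closed)
  have "S \<subseteq> range (\<lambda>n::int. s [^]\<^bsub>K\<^esub> n)"
  proof
    fix y assume y: "y \<in> S"
    then obtain m :: int where m: "y = x [^]\<^bsub>K\<^esub> m"
      using sub K subgroup.subset by blast
    define q e where "q = m div int d" and "e = m mod int d"
    have me: "m = int d * q + e" unfolding q_def e_def by simp
    have e0: "0 \<le> e" "e < int d" using d by (auto simp: e_def)
    have sq: "s [^]\<^bsub>K\<^esub> q = x [^]\<^bsub>K\<^esub> (int d * q)"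
      unfolding s_def using x by (metis int_pow_int int_pow_pow)
    have "x [^]\<^bsub>K\<^esub> e = s [^]\<^bsub>K\<^esub> (- q) \<otimes>\<^bsub>K\<^esub> y"
    proof -
      have "s [^]\<^bsub>K\<^esub> (- q) = x [^]\<^bsub>K\<^esub> (int d * (- q))"
        unfolding s_def using x by (metis int_pow_int int_pow_pow)
      then have "s [^]\<^bsub>K\<^esub> (- q) \<otimes>\<^bsub>K\<^esub> y = x [^]\<^bsub>K\<^esub> (int d * (- q) + m)"
        unfolding m using x by (simp only: int_pow_mult)
      then show ?thesis by (simp add: me)
    qed
    then have "x [^]\<^bsub>K\<^esub> e \<in> S"
      using powS y sub by (simp add: subgroup.m_closed)
    then have "x [^]\<^bsub>K\<^esub> nat e \<in> S"
      using e0 by (metis int_pow_int nat_0_le)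
    moreover have "nat e < d" using e0 by linarith
    ultimately have "nat e = 0" using least[of "nat e"] by (auto simp: P_def)
    then have "m = int d * q" using me e0 by simp
    then have "y = s [^]\<^bsub>K\<^esub> q" using m sq by simp
    then show "y \<in> range (\<lambda>n::int. s [^]\<^bsub>K\<^esub> n)" by blast
  qed
  then show ?thesis using s powS by blast
qed

lemma procyclic_if_inverse_limit:
  fixes G :: "('a, 'c) monoid_scheme" and T :: "'a topology"
    and I :: "'i set" and H :: "'i \<Rightarrow> 'b monoid"
  assumes G: "group G" and T: "topspace T = carrier G"
    and sys: "inverse_system I r H \<phi>"
    and fc: "\<And>i. i \<in> I \<Longrightarrow> finite (carrier (H i)) \<and> cyclic_group (H i)"
    and iso: "topological_group_iso G T (inverse_limit_group I r H \<phi>) (inverse_limit_topology I r H \<phi>) h"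
  shows "procyclic G T"
proof -
  interpret G: group G by fact
  interpret inverse_system I r H \<phi> by fact
  define L where "L = inverse_limit_carrier I r H \<phi>"
  have r: "i \<in> I" "j \<in> I" if "(i, j) \<in> r" for i j
    using partial_order_onD(4)[OF partial_order] that by auto
  have top_lim: "topspace (inverse_limit_topology I r H \<phi>) = L"
    unfolding inverse_limit_topology_def L_def
    by (auto simp: inverse_limit_carrier_def)
  have h_hom: "h \<in> hom G (inverse_limit_group I r H \<phi>)"
    and h_bij: "bij_betw h (carrier G) L"
    using iso by (auto simp: topological_group_iso_def iso_def inverse_limit_group_def L_def)
  obtain h' where hh': "homeomorphic_maps T (inverse_limit_topology I r H \<phi>) h h'"
    using iso homeomorphic_map_maps unfolding topological_group_iso_def by blast
  have h'L: "h' y \<in> carrier G" "h (h' y) = y" if "y \<in> L" for y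
    using hh' that continuous_map_image_subset_topspace[of "inverse_limit_topology I r H \<phi>" T h']
    unfolding homeomorphic_maps_def top_lim T by (auto simp: continuous_map_def top_lim T)
  have h'h: "h' (h x) = x" if "x \<in> carrier G" for x
    using hh' that unfolding homeomorphic_maps_def T by auto
  have hL: "h x \<in> L" if "x \<in> carrier G" for x
    using h_bij that by (auto simp: bij_betw_def)
  have LH: "y i \<in> carrier (H i)" if "y \<in> L" "i \<in> I" for y i
    using that by (auto simp: L_def inverse_limit_carrier_def PiE_iff)
  have L\<phi>: "\<phi> i j (y j) = y i" if "y \<in> L" "(i, j) \<in> r" for y i j
    using that by (auto simp: L_def inverse_limit_carrier_def)
  define p where "p = (\<lambda>i x. h x i)"
  have p_hom: "p i \<in> hom G (H i)" if i: "i \<in> I" for i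
  proof (rule homI)
    show "p i x \<in> carrier (H i)" if "x \<in> carrier G" for x
      using LH[OF hL[OF that] i] by (simp add: p_def)
    show "p i (x \<otimes>\<^bsub>G\<^esub> y) = p i x \<otimes>\<^bsub>H i\<^esub> p i y" if "x \<in> carrier G" "y \<in> carrier G" for x y
      using hom_mult[OF h_hom that] i by (simp add: p_def inverse_limit_group_def)
  qed
  have p_cont: "continuous_map T (discrete_topology (carrier (H i))) (p i)" if "i \<in> I" for i
  proof -
    have "continuous_map T (product_topology (\<lambda>i. discrete_topology (carrier (H i))) I) h"
      using hh' unfolding homeomorphic_maps_def inverse_limit_topology_def
      by (auto simp: continuous_map_in_subtopology)
    then show ?thesis
      using that unfolding p_def by (auto simp: continuous_map_componentwise)
  qed
  have p_rel: "\<phi> i j (p j x) = p i x" if "(i, j) \<in> r" "x \<in> carrier G" for i j x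
    using L\<phi>[OF hL[OF that(2)] that(1)] by (simp add: p_def)

  define N where "N = (\<lambda>i. kernel G (H i) (p i))"
  have gh: "group_hom G (H i) (p i)" if "i \<in> I" for i
    using p_hom[OF that] groups[OF that] G by (simp add: group_hom_def group_hom_axioms_def)
  have N_normal: "N i \<lhd> G" if "i \<in> I" for i
    using group_hom.normal_kernel[OF gh[OF that]] by (simp add: N_def)
  have same_coset: "N i #>\<^bsub>G\<^esub> x = N i #>\<^bsub>G\<^esub> y \<longleftrightarrow> p i x = p i y"
    if i: "i \<in> I" and x: "x \<in> carrier G" and y: "y \<in> carrier G" for i x y
  proof -
    interpret group_hom G "H i" "p i" by (rule gh[OF i])
    interpret N: normal "N i" G by (rule N_normal[OF i])
    have "N i #>\<^bsub>G\<^esub> x = N i #>\<^bsub>G\<^esub> y \<longleftrightarrow> x \<otimes>\<^bsub>G\<^esub> inv\<^bsub>G\<^esub> y \<in> N i"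
    proof
      assume "N i #>\<^bsub>G\<^esub> x = N i #>\<^bsub>G\<^esub> y"
      then have "x \<in> N i #>\<^bsub>G\<^esub> y"
        using G.rcos_self[OF x N.subgroup_axioms] by simp
      then show "x \<otimes>\<^bsub>G\<^esub> inv\<^bsub>G\<^esub> y \<in> N i"
        using N.rcos_module[OF G y x] by simp
    next
      assume "x \<otimes>\<^bsub>G\<^esub> inv\<^bsub>G\<^esub> y \<in> N i"
      then have "x \<in> N i #>\<^bsub>G\<^esub> y"
        using N.rcos_module[OF G y x] by simp
      then show "N i #>\<^bsub>G\<^esub> x = N i #>\<^bsub>G\<^esub> y"
        using y N.subgroup_axioms G.repr_independence by blast
    qed
    also have "\<dots> \<longleftrightarrow> p i x \<otimes>\<^bsub>H i\<^esub> inv\<^bsub>H i\<^esub> p i y = \<one>\<^bsub>H i\<^esub>"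
    proof -
      have "x \<otimes>\<^bsub>G\<^esub> inv\<^bsub>G\<^esub> y \<in> N i \<longleftrightarrow> p i (x \<otimes>\<^bsub>G\<^esub> inv\<^bsub>G\<^esub> y) = \<one>\<^bsub>H i\<^esub>"
        unfolding N_def kernel_def using x y by blast
      then show ?thesis using x y by (simp only: hom_mult G.inv_closed hom_inv)
    qed
    also have "\<dots> \<longleftrightarrow> p i x = p i y"
    proof
      have c: "p i x \<in> carrier (H i)" "p i y \<in> carrier (H i)" using x y by auto
      show "p i x = p i y" if "p i x \<otimes>\<^bsub>H i\<^esub> inv\<^bsub>H i\<^esub> p i y = \<one>\<^bsub>H i\<^esub>"
        using H.inv_equality[OF that] c by simp
      show "p i x \<otimes>\<^bsub>H i\<^esub> inv\<^bsub>H i\<^esub> p i y = \<one>\<^bsub>H i\<^esub>" if "p i x = p i y"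
        using that c by simp
    qed
    finally show ?thesis .
  qed
  have N_mono: "N j \<subseteq> N i" if "(i, j) \<in> r" for i j
  proof
    fix x assume x: "x \<in> N j"
    then have xc: "x \<in> carrier G" and "p j x = \<one>\<^bsub>H j\<^esub>"
      by (auto simp: N_def kernel_def)
    then have "p i x = \<phi> i j \<one>\<^bsub>H j\<^esub>"
      using p_rel[OF that xc] by simp
    also have "\<dots> = \<one>\<^bsub>H i\<^esub>"
      using hom_one[OF hom[OF that]] groups r[OF that] by blast
    finally show "x \<in> N i" using xc by (simp add: N_def kernel_def)
  qed

  define J where "J = N ` I"
  define s where "s = {(A, B). A \<in> J \<and> B \<in> J \<and> B \<subseteq> A}"
  define Q where "Q = (\<lambda>A. G Mod A)"
  define \<psi> where "\<psi> = (\<lambda>A (B :: 'a set) C. A <#>\<^bsub>G\<^esub> C)"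
  have J_normal: "A \<lhd> G" if "A \<in> J" for A
    using that N_normal by (auto simp: J_def)
  have \<psi>_coset: "\<psi> A B (B #>\<^bsub>G\<^esub> x) = A #>\<^bsub>G\<^esub> x" if "(A, B) \<in> s" "x \<in> carrier G" for A B x
  proof -
    interpret A: normal A G using J_normal that by (auto simp: s_def)
    interpret B: normal B G using J_normal that by (auto simp: s_def)
    have BA: "B \<subseteq> A" using that by (auto simp: s_def)
    have "A <#>\<^bsub>G\<^esub> B = A"
    proof
      show "A <#>\<^bsub>G\<^esub> B \<subseteq> A" using BA by (auto simp: set_mult_def)
      show "A \<subseteq> A <#>\<^bsub>G\<^esub> B"
      proof
        fix a assume a: "a \<in> A"
        then have "a = a \<otimes>\<^bsub>G\<^esub> \<one>\<^bsub>G\<^esub>" using A.subset by auto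
        then show "a \<in> A <#>\<^bsub>G\<^esub> B"
          unfolding set_mult_def using a B.one_closed by blast
      qed
    qed
    moreover have "A <#>\<^bsub>G\<^esub> (B #>\<^bsub>G\<^esub> x) = (A <#>\<^bsub>G\<^esub> B) #>\<^bsub>G\<^esub> x"
      using G.setmult_rcos_assoc[OF A.subset B.subset that(2)] by simp
    ultimately show ?thesis by (simp add: \<psi>_def)
  qed
  have Q_carrier: "carrier (Q A) = (\<lambda>x. A #>\<^bsub>G\<^esub> x) ` carrier G" for A
    by (simp add: Q_def carrier_FactGroup)
  have Q_mult: "(A #>\<^bsub>G\<^esub> x) \<otimes>\<^bsub>Q A\<^esub> (A #>\<^bsub>G\<^esub> y) = A #>\<^bsub>G\<^esub> (x \<otimes>\<^bsub>G\<^esub> y)"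
    if "A \<in> J" "x \<in> carrier G" "y \<in> carrier G" for A x y
    using normal.rcos_sum[OF J_normal[OF that(1)] that(2,3)] by (simp add: Q_def)
  have Q_group: "group (Q A)" if "A \<in> J" for A
    using normal.factorgroup_is_group[OF J_normal[OF that]] by (simp add: Q_def)

  have sys': "inverse_system J s Q \<psi>"
  proof (rule inverse_system.intro)
    show "partial_order_on J s"
      by (auto simp: s_def order_on_defs refl_on_def trans_def antisym_def)
    show "J \<noteq> {}" using nonempty by (simp add: J_def)
    show "\<exists>C\<in>J. (A, C) \<in> s \<and> (B, C) \<in> s" if AB: "A \<in> J" "B \<in> J" for A B
    proof -
      obtain i j where ij: "i \<in> I" "j \<in> I" "A = N i" "B = N j"
        using AB unfolding J_def by blast
      obtain k where k: "k \<in> I" "(i, k) \<in> r" "(j, k) \<in> r"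
        using directed[OF ij(1,2)] by blast
      show ?thesis
        using ij k N_mono by (intro bexI[of _ "N k"]) (auto simp: s_def J_def)
    qed
    show "group (Q A)" if "A \<in> J" for A by (rule Q_group[OF that])
    show "\<psi> A B \<in> hom (Q B) (Q A)" if AB: "(A, B) \<in> s" for A B
    proof (rule homI)
      show "\<psi> A B C \<in> carrier (Q A)" if "C \<in> carrier (Q B)" for C
        using that \<psi>_coset[OF AB] by (auto simp: Q_carrier)
      show "\<psi> A B (C \<otimes>\<^bsub>Q B\<^esub> D) = \<psi> A B C \<otimes>\<^bsub>Q A\<^esub> \<psi> A B D"
        if "C \<in> carrier (Q B)" "D \<in> carrier (Q B)" for C D
        using that AB by (auto simp: Q_carrier Q_mult \<psi>_coset[OF AB] s_def)
    qed
    show "\<psi> A A C = C" if "A \<in> J" "C \<in> carrier (Q A)" for A C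
      using that \<psi>_coset[of A A] by (auto simp: Q_carrier s_def)
    show "\<psi> A B (\<psi> B D C) = \<psi> A D C" if "(A, B) \<in> s" "(B, D) \<in> s" "C \<in> carrier (Q D)" for A B D C
    proof -
      have "(A, D) \<in> s" using that by (auto simp: s_def)
      then show ?thesis using that by (auto simp: Q_carrier \<psi>_coset)
    qed
  qed

  define val where "val = (\<lambda>i C. p i (SOME x. x \<in> carrier G \<and> C = N i #>\<^bsub>G\<^esub> x))"
  have val: "val i (N i #>\<^bsub>G\<^esub> x) = p i x" if i: "i \<in> I" and x: "x \<in> carrier G" for i x
  proof -
    define z where "z = (SOME z. z \<in> carrier G \<and> N i #>\<^bsub>G\<^esub> x = N i #>\<^bsub>G\<^esub> z)"
    have "z \<in> carrier G \<and> N i #>\<^bsub>G\<^esub> x = N i #>\<^bsub>G\<^esub> z"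
      unfolding z_def by (rule someI[of _ x]) (use x in simp)
    then have "p i x = p i z" using same_coset[OF i x] by blast
    then show ?thesis unfolding val_def z_def by (rule sym)
  qed

  have fc': "finite (carrier (Q A)) \<and> cyclic_group (Q A)" if A: "A \<in> J" for A
  proof -
    obtain i where i: "i \<in> I" and Ai: "A = N i" using A by (auto simp: J_def)
    interpret group_hom G "H i" "p i" by (rule gh[OF i])
    interpret Q: group "Q A" by (rule Q_group[OF A])
    have sub: "subgroup (p i ` carrier G) (H i)" by (rule img_is_subgroup)
    then obtain y where y: "y \<in> p i ` carrier G"
      and gen: "p i ` carrier G = range (\<lambda>n::int. y [^]\<^bsub>H i\<^esub> n)"
      using finite_cyclic_subgroup_cyclic[OF groups[OF i]] fc[OF i] by blast
    obtain g where g: "g \<in> carrier G" "y = p i g" using y by blast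
    interpret nat: group_hom G "Q A" "\<lambda>x. A #>\<^bsub>G\<^esub> x"
      using normal.r_coset_hom_Mod[OF J_normal[OF A]] G Q.group_axioms
      by (simp add: group_hom_def group_hom_axioms_def Q_def)
    have "carrier (Q A) = range (\<lambda>n::int. (A #>\<^bsub>G\<^esub> g) [^]\<^bsub>Q A\<^esub> n)"
    proof
      show "carrier (Q A) \<subseteq> range (\<lambda>n::int. (A #>\<^bsub>G\<^esub> g) [^]\<^bsub>Q A\<^esub> n)"
      proof
        fix C assume "C \<in> carrier (Q A)"
        then obtain x where x: "x \<in> carrier G" "C = A #>\<^bsub>G\<^esub> x" by (auto simp: Q_carrier)
        then obtain n :: int where "p i x = y [^]\<^bsub>H i\<^esub> n" using gen by blast
        then have "p i x = p i (g [^]\<^bsub>G\<^esub> n)" using g by (simp add: hom_int_pow)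
        then have "C = A #>\<^bsub>G\<^esub> (g [^]\<^bsub>G\<^esub> n)"
          using same_coset[OF i x(1), of "g [^]\<^bsub>G\<^esub> n"] g x Ai by simp
        also have "\<dots> = (A #>\<^bsub>G\<^esub> g) [^]\<^bsub>Q A\<^esub> n" using g by (simp add: nat.hom_int_pow)
        finally show "C \<in> range (\<lambda>n::int. (A #>\<^bsub>G\<^esub> g) [^]\<^bsub>Q A\<^esub> n)" by blast
      qed
      show "range (\<lambda>n::int. (A #>\<^bsub>G\<^esub> g) [^]\<^bsub>Q A\<^esub> n) \<subseteq> carrier (Q A)"
        using g by auto
    qed
    then have "cyclic_group (Q A)"
      using Q.cyclic_group nat.hom_closed[OF g(1)] by blast
    moreover have "finite (carrier (Q A))"
    proof -
      have "finite (p i ` carrier G)"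
        using fc[OF i] subgroup.subset[OF sub] finite_subset by blast
      moreover have "inj_on (val i) (carrier (Q A))"
      proof (rule inj_onI)
        fix C D assume CD: "C \<in> carrier (Q A)" "D \<in> carrier (Q A)" "val i C = val i D"
        then obtain x y where xy: "x \<in> carrier G" "y \<in> carrier G" "C = N i #>\<^bsub>G\<^esub> x" "D = N i #>\<^bsub>G\<^esub> y"
          unfolding Q_carrier Ai by blast
        then have "p i x = p i y" using CD(3) by (simp only: val[OF i])
        then show "C = D" using xy same_coset[OF i] by blast
      qed
      moreover have "val i ` carrier (Q A) \<subseteq> p i ` carrier G"
        unfolding Q_carrier Ai using val[OF i] by blast
      ultimately show ?thesis using inj_on_finite by blast
    qed
    ultimately show ?thesis by blast
  qed

  define M where "M = inverse_limit_carrier J s Q \<psi>"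
  define f where "f = (\<lambda>x. \<lambda>A\<in>J. A #>\<^bsub>G\<^esub> x)"
  define k where "k = (\<lambda>c. \<lambda>i\<in>I. val i (c (N i)))"
  have fM: "f x \<in> M" if "x \<in> carrier G" for x
    using that \<psi>_coset
    by (auto simp: M_def f_def inverse_limit_carrier_def Q_carrier) (auto simp: s_def)
  have kf: "k (f x) = h x" if x: "x \<in> carrier G" for x
  proof
    fix i
    show "k (f x) i = h x i"
    proof (cases "i \<in> I")
      case True
      then show ?thesis using x by (simp add: k_def f_def J_def val p_def)
    next
      case False
      then show ?thesis
        using hL[OF x] by (auto simp: k_def L_def inverse_limit_carrier_def PiE_def extensional_def)
    qed
  qed
  have Mrep: "\<exists>x\<in>carrier G. c (N i) = N i #>\<^bsub>G\<^esub> x" if "c \<in> M" "i \<in> I" for c i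
  proof -
    have "c (N i) \<in> carrier (Q (N i))"
      using that by (auto simp: M_def inverse_limit_carrier_def PiE_iff J_def)
    then show ?thesis unfolding Q_carrier by blast
  qed
  have M\<psi>: "\<psi> A B (c B) = c A" if "c \<in> M" "(A, B) \<in> s" for c A B
    using that by (auto simp: M_def inverse_limit_carrier_def)
  have kL: "k c \<in> L" if c: "c \<in> M" for c
  proof -
    have "k c \<in> (\<Pi>\<^sub>E i\<in>I. carrier (H i))"
    proof (rule PiE_I)
      fix i assume i: "i \<in> I"
      obtain x where "x \<in> carrier G" "c (N i) = N i #>\<^bsub>G\<^esub> x" using Mrep[OF c i] by blast
      then show "k c i \<in> carrier (H i)"
        using i p_hom[OF i] by (auto simp: k_def val hom_def)
    qed (simp add: k_def)
    moreover have "\<phi> i j (k c j) = k c i" if ij: "(i, j) \<in> r" for i j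
    proof -
      have I: "i \<in> I" "j \<in> I" using r[OF ij] by auto
      obtain x where x: "x \<in> carrier G" "c (N j) = N j #>\<^bsub>G\<^esub> x" using Mrep[OF c I(2)] by blast
      have S: "(N i, N j) \<in> s" using I N_mono[OF ij] by (auto simp: s_def J_def)
      have "c (N i) = N i #>\<^bsub>G\<^esub> x"
        using M\<psi>[OF c S] \<psi>_coset[OF S x(1)] x(2) by simp
      then show ?thesis
        using x I p_rel[OF ij x(1)] by (simp add: k_def val)
    qed
    ultimately show ?thesis by (auto simp: L_def inverse_limit_carrier_def)
  qed
  have fg: "f (h' (k c)) = c" if c: "c \<in> M" for c
  proof
    fix A
    define g where "g = h' (k c)"
    have g: "g \<in> carrier G" "h g = k c" using h'L[OF kL[OF c]] by (auto simp: g_def)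
    show "f (h' (k c)) A = c A"
    proof (cases "A \<in> J")
      case True
      then obtain i where i: "i \<in> I" "A = N i" by (auto simp: J_def)
      obtain x where x: "x \<in> carrier G" "c (N i) = N i #>\<^bsub>G\<^esub> x" using Mrep[OF c i(1)] by blast
      have "p i g = p i x"
        using g i x by (simp add: p_def[of] k_def val[OF i(1) x(1), unfolded p_def])
      then have "N i #>\<^bsub>G\<^esub> g = N i #>\<^bsub>G\<^esub> x"
        using same_coset[OF i(1) g(1) x(1)] by simp
      then show ?thesis using True i x by (simp add: f_def g_def)
    next
      case False
      then show ?thesis
        using c by (auto simp: f_def M_def inverse_limit_carrier_def PiE_def extensional_def)
    qed
  qed
  have top_M: "topspace (inverse_limit_topology J s Q \<psi>) = M"
    unfolding inverse_limit_topology_def M_def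
    by (auto simp: inverse_limit_carrier_def)
  have f_cont: "continuous_map T (inverse_limit_topology J s Q \<psi>) f"
  proof -
    have "continuous_map T (discrete_topology (carrier (Q A))) (\<lambda>x. f x A)" if A: "A \<in> J" for A
    proof -
      obtain i where i: "i \<in> I" "A = N i" using A by (auto simp: J_def)
      have "continuous_map (discrete_topology (carrier (H i))) (discrete_topology (carrier (Q A)))
              (\<lambda>v. if v \<in> p i ` carrier G then A #>\<^bsub>G\<^esub> (SOME x. x \<in> carrier G \<and> p i x = v) else \<one>\<^bsub>Q A\<^esub>)"
      proof -
        have "(SOME x. x \<in> carrier G \<and> p i x = p i z) \<in> carrier G" if "z \<in> carrier G" for z
          using someI[of "\<lambda>x. x \<in> carrier G \<and> p i x = p i z" z] that by blast
        then show ?thesis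
          using monoid.one_closed[OF group.is_monoid[OF Q_group[OF A]]]
          by (auto simp: Q_carrier)
      qed
      from continuous_map_compose[OF p_cont[OF i(1)] this]
      show ?thesis
      proof (rule continuous_map_eq)
        fix x assume "x \<in> topspace T"
        then have x: "x \<in> carrier G" by (simp add: T)
        define z where "z = (SOME z. z \<in> carrier G \<and> p i z = p i x)"
        have z: "z \<in> carrier G \<and> p i z = p i x"
          unfolding z_def by (rule someI[of _ x]) (use x in simp)
        then have "A #>\<^bsub>G\<^esub> z = A #>\<^bsub>G\<^esub> x"
          unfolding i(2) using same_coset[OF i(1) _ x, of z] by blast
        then show "((\<lambda>v. if v \<in> p i ` carrier G then A #>\<^bsub>G\<^esub> (SOME x. x \<in> carrier G \<and> p i x = v) else \<one>\<^bsub>Q A\<^esub>) \<circ> p i) x = f x A"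
          using x A by (simp add: f_def z_def)
      qed
    qed
    then have "continuous_map T (product_topology (\<lambda>A. discrete_topology (carrier (Q A))) J) f"
      unfolding continuous_map_componentwise by (auto simp: f_def)
    then show ?thesis
      unfolding inverse_limit_topology_def continuous_map_in_subtopology
      using fM by (auto simp: T M_def)
  qed
  have k_cont: "continuous_map (inverse_limit_topology J s Q \<psi>) (inverse_limit_topology I r H \<phi>) k"
  proof -
    have "continuous_map (inverse_limit_topology J s Q \<psi>) (discrete_topology (carrier (H i))) (\<lambda>c. k c i)"
      if i: "i \<in> I" for i
    proof -
      have NJ: "N i \<in> J" using i by (simp add: J_def)
      have "continuous_map (inverse_limit_topology J s Q \<psi>) (discrete_topology (carrier (Q (N i)))) (\<lambda>c. c (N i))"
        unfolding inverse_limit_topology_def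
        using NJ by (intro continuous_map_from_subtopology continuous_map_product_projection)
      moreover have "continuous_map (discrete_topology (carrier (Q (N i)))) (discrete_topology (carrier (H i))) (val i)"
        using val[OF i] p_hom[OF i] by (auto simp: Q_carrier hom_def)
      ultimately have "continuous_map (inverse_limit_topology J s Q \<psi>) (discrete_topology (carrier (H i))) (val i \<circ> (\<lambda>c. c (N i)))"
        by (rule continuous_map_compose)
      then show ?thesis using i by (simp add: k_def comp_def)
    qed
    then have "continuous_map (inverse_limit_topology J s Q \<psi>) (product_topology (\<lambda>i. discrete_topology (carrier (H i))) I) k"
      unfolding continuous_map_componentwise by (auto simp: k_def)
    then show ?thesis
      unfolding inverse_limit_topology_def[of I] continuous_map_in_subtopology
      using kL by (auto simp: top_M L_def)
  qed
  have "homeomorphic_maps T (inverse_limit_topology J s Q \<psi>) f (h' \<circ> k)"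
    unfolding homeomorphic_maps_def
    using f_cont continuous_map_compose[OF k_cont, of T h'] hh' kf h'h fg
    by (auto simp: homeomorphic_maps_def T top_M)
  then have homeo: "homeomorphic_map T (inverse_limit_topology J s Q \<psi>) f"
    using homeomorphic_map_maps by blast
  have "f \<in> hom G (inverse_limit_group J s Q \<psi>)"
  proof (rule homI)
    show "f x \<in> carrier (inverse_limit_group J s Q \<psi>)" if "x \<in> carrier G" for x
      using fM[OF that] by (simp add: inverse_limit_group_def M_def)
    show "f (x \<otimes>\<^bsub>G\<^esub> y) = f x \<otimes>\<^bsub>inverse_limit_group J s Q \<psi>\<^esub> f y"
      if "x \<in> carrier G" "y \<in> carrier G" for x y
      using that by (auto simp: inverse_limit_group_def f_def Q_mult intro!: restrict_ext)
  qed
  moreover have "bij_betw f (carrier G) (carrier (inverse_limit_group J s Q \<psi>))"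
    using homeo[unfolded homeomorphic_eq_everything_map]
    by (simp add: T top_M bij_betw_def inverse_limit_group_def M_def)
  ultimately have "topological_group_iso G T (inverse_limit_group J s Q \<psi>) (inverse_limit_topology J s Q \<psi>) f"
    using homeo by (simp add: topological_group_iso_def iso_def)
  then show ?thesis
    unfolding procyclic_def using sys' fc' by blast
qed

subsection \<open>Subgroup lattices\<close>

definition closed_subgroups :: "('a, 'c) monoid_scheme \<Rightarrow> 'a topology \<Rightarrow> 'a set set" where
  "closed_subgroups G T = {X. subgroup X G \<and> closedin T X}"

definition open_subgroups :: "('a, 'c) monoid_scheme \<Rightarrow> 'a topology \<Rightarrow> 'a set set" where
  "open_subgroups G T = {X. subgroup X G \<and> openin T X}"

definition subgroup_join :: "('a, 'c) monoid_scheme \<Rightarrow> 'a set \<Rightarrow> 'a set \<Rightarrow> 'a set" where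
  "subgroup_join G X Y = generate G (X \<union> Y)"

definition closed_subgroup_join ::
    "('a, 'c) monoid_scheme \<Rightarrow> 'a topology \<Rightarrow> 'a set \<Rightarrow> 'a set \<Rightarrow> 'a set" where
  "closed_subgroup_join G T X Y = T closure_of (generate G (X \<union> Y))"

text \<open>Distributivity of the lattice with underlying set \<open>L\<close>, join \<open>j\<close> and meet \<open>m\<close>.\<close>

definition distributive :: "'l set \<Rightarrow> ('l \<Rightarrow> 'l \<Rightarrow> 'l) \<Rightarrow> ('l \<Rightarrow> 'l \<Rightarrow> 'l) \<Rightarrow> bool" where
  "distributive L j m \<longleftrightarrow> (\<forall>x\<in>L. \<forall>y\<in>L. \<forall>z\<in>L. j x (m y z) = m (j x y) (j x z))"

end

(*
If the lattice of open subgroups is distributive, then so is the subgroup lattice of each finite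
quotient G/N by an open normal subgroup, and a finite group with distributive subgroup lattice is
cyclic (Ore): distributivity writes the subgroup generated by ab as the join of its intersections
with the subgroups generated by a and by b. These intersections commute with a, hence the group is
abelian; if a generates a maximal cyclic subgroup, the same identity forces that subgroup to be
everything. A profinite group is the inverse limit of its quotients G/N, because the two-sided
stabilizer of a clopen set is an open normal subgroup.

Conversely, if G is the inverse limit of finite cyclic groups, then x in (X v Y) meet (X v Z) can be
written, modulo each finite level, as a product of elements of X and of Y meet Z, since finite cyclic
groups have distributive subgroup lattices; compactness makes one choice work at all levels.
*)
theory Submission
  imports Defs
begin

section \<open>Subgroup lattices of cyclic groups\<close>

lemma (in group) mult_mem_generate_Un:
  assumes "x \<in> X" "y \<in> Y" shows "x \<otimes> y \<in> generate G (X \<union> Y)"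
  using assms by (intro generate.eng generate.incl) auto

text \<open>Commutativity makes the product set a subgroup; joins in the finite quotients can thus
  be handled as sets of products.\<close>

lemma (in comm_group) generate_Un_subset_set_mult:
  assumes S: "subgroup S G" and T: "subgroup T G"
  shows "generate G (S \<union> T) \<subseteq> S <#> T"
proof (rule generate_subgroup_incl)
  have "s \<otimes> t \<in> S <#> T" if "s \<in> S" "t \<in> T" for s t
    unfolding set_mult_def using that by blast
  then have "s \<otimes> \<one> \<in> S <#> T" "\<one> \<otimes> t \<in> S <#> T" if "s \<in> S" "t \<in> T" for s t
    using that S T by (simp_all add: subgroup.one_closed)
  then have "s \<in> S <#> T" "t \<in> S <#> T" if "s \<in> S" "t \<in> T" for s t
    using that S T by (metis subgroup.mem_carrier r_one, metis subgroup.mem_carrier l_one)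
  then show "S \<union> T \<subseteq> S <#> T" using S T subgroup.one_closed by blast
qed (rule mult_subgroups[OF S T])

text \<open>The cofactors are \<open>b\<close> and \<open>c\<close> divided by their gcd; the case
  \<open>b = c = 0\<close> is split off because the gcd then vanishes.\<close>

lemma int_common_multiple_coprime_cofactors:
  fixes b c :: int
  obtains b' c' u v where "b * c' = c * b'" "u * b' + v * c' = 1"
proof (cases "b = 0 \<and> c = 0")
  case True
  then show ?thesis using that[of 0 1 1 0] by simp
next
  case False
  define d where "d = gcd b c"
  have d: "d \<noteq> 0" using False by (simp add: d_def)
  obtain b' c' where bc: "b = d * b'" "c = d * c'"
    unfolding d_def by (meson dvdE gcd_dvd1 gcd_dvd2)
  obtain u v where "u * b + v * c = d" unfolding d_def using bezout_int by blast
  then have "d * (u * b' + v * c') = d * 1" using bc by (simp add: algebra_simps)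
  then have "u * b' + v * c' = 1" using d by (simp only: mult_cancel_left) simp
  moreover have "b * c' = c * b'" using bc by simp
  ultimately show ?thesis using that by blast
qed

text \<open>Let \<open>T\<close> and \<open>U\<close> consist of the powers of
  \<open>t = g^b\<close> and \<open>u = g^c\<close>, and write \<open>1 = m b' + n c'\<close> with
  the coprime cofactors of \<open>b\<close> and \<open>c\<close>. For
  \<open>x = s t^j = s' u^k\<close>, both factors of \<open>x = x^(m b') x^(n c')\<close> lie in
  \<open>S\<close> times the powers of \<open>w = t^c' = u^b'\<close>, an element of
  \<open>T \<inter> U\<close>.\<close>

lemma (in group) cyclic_set_mult_Int_distrib:
  assumes cyc: "cyclic_group G" and fin: "finite (carrier G)"
    and S: "subgroup S G" and T: "subgroup T G" and U: "subgroup U G"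
  shows "(S <#> T) \<inter> (S <#> U) \<subseteq> S <#> (T \<inter> U)"
proof
  interpret comm_group G using cyclic_imp_abelian_group[OF cyc] .
  obtain g where g: "g \<in> carrier G" and G: "carrier G = range (\<lambda>n::int. g [^] n)"
    using cyc cyclic_group by blast
  obtain t where t: "t \<in> T" "T = range (\<lambda>n::int. t [^] n)"
    using finite_cyclic_subgroup_cyclic[OF is_group cyc fin T] by blast
  obtain u where u: "u \<in> U" "U = range (\<lambda>n::int. u [^] n)"
    using finite_cyclic_subgroup_cyclic[OF is_group cyc fin U] by blast
  have tc: "t \<in> carrier G" and uc: "u \<in> carrier G"
    using t(1) u(1) subgroup.mem_carrier[OF T] subgroup.mem_carrier[OF U] by auto
  obtain b where b: "t = g [^] (b::int)" using tc G by blast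
  obtain c where c: "u = g [^] (c::int)" using uc G by blast
  obtain b' c' m n where bc: "b * c' = c * b'" and mn: "m * b' + n * c' = 1"
    by (rule int_common_multiple_coprime_cofactors)
  define w where "w = t [^] c'"
  have w: "w = u [^] b'" unfolding w_def b c using g bc by (simp add: int_pow_pow)
  have wT: "w [^] (k::int) \<in> T \<inter> U" for k
    using w w_def t(1) u(1) T U by (metis IntI subgroup_int_pow_closed)
  have wc: "w \<in> carrier G" using tc by (simp add: w_def)
  fix x assume "x \<in> (S <#> T) \<inter> (S <#> U)"
  then obtain s s' y z where "s \<in> S" "s' \<in> S" "y \<in> T" "z \<in> U" "x = s \<otimes> y" "x = s' \<otimes> z"
    unfolding set_mult_def by blast
  then obtain j k :: int where s: "s \<in> S" "s' \<in> S" and x: "x = s \<otimes> t [^] j" "x = s' \<otimes> u [^] k"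
    using t(2) u(2) by blast
  have sc: "s \<in> carrier G" "s' \<in> carrier G" using s subgroup.mem_carrier[OF S] by auto
  have xc: "x \<in> carrier G" using x(1) sc tc by simp
  have x1: "x [^] (n * c') = s [^] (n * c') \<otimes> w [^] (j * n)"
  proof -
    have "x [^] (n * c') = s [^] (n * c') \<otimes> t [^] (j * (n * c'))"
      unfolding x(1) using sc tc by (simp add: int_pow_distrib int_pow_pow)
    moreover have "w [^] (j * n) = t [^] (j * (n * c'))"
      unfolding w_def using tc by (simp add: int_pow_pow ac_simps)
    ultimately show ?thesis by simp
  qed
  have x2: "x [^] (m * b') = s' [^] (m * b') \<otimes> w [^] (k * m)"
  proof -
    have "x [^] (m * b') = s' [^] (m * b') \<otimes> u [^] (k * (m * b'))"
      unfolding x(2) using sc uc by (simp add: int_pow_distrib int_pow_pow)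
    moreover have "w [^] (k * m) = u [^] (k * (m * b'))"
      unfolding w using uc by (simp add: int_pow_pow ac_simps)
    ultimately show ?thesis by simp
  qed
  have "x = x [^] (m * b' + n * c')" using xc mn by simp
  also have "\<dots> = x [^] (m * b') \<otimes> x [^] (n * c')" using xc by (rule int_pow_mult)
  also have "\<dots> = (s' [^] (m * b') \<otimes> s [^] (n * c')) \<otimes> (w [^] (k * m) \<otimes> w [^] (j * n))"
    unfolding x1 x2 using sc wc by (simp add: m_ac)
  also have "w [^] (k * m) \<otimes> w [^] (j * n) = w [^] (k * m + j * n)"
    using wc by (simp add: int_pow_mult)
  finally have "x = (s' [^] (m * b') \<otimes> s [^] (n * c')) \<otimes> w [^] (k * m + j * n)" .
  moreover have "s' [^] (m * b') \<otimes> s [^] (n * c') \<in> S"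
    using s S by (simp add: subgroup.m_closed subgroup_int_pow_closed)
  ultimately show "x \<in> S <#> (T \<inter> U)"
    unfolding set_mult_def using wT by blast
qed

section \<open>Groups with distributive subgroup lattice\<close>

text \<open>Meet over join follows from join over meet: the law with common term \<open>B\<close>
  puts \<open>C\<close> inside the join of \<open>B\<close> and \<open>C \<inter> A\<close>, and a
  second use with common term \<open>C \<inter> A\<close> finishes.\<close>

lemma (in group) distributive_imp_subset_join_Int:
  assumes D: "distributive {H. subgroup H G} (subgroup_join G) (\<inter>)"
    and A: "subgroup A G" and B: "subgroup B G" and C: "subgroup C G"
    and sub: "C \<subseteq> generate G (A \<union> B)"
  shows "C \<subseteq> generate G ((C \<inter> A) \<union> (C \<inter> B))"
proof -
  have CA: "subgroup (C \<inter> A) G" using A C by (simp add: subgroups_Inter_pair)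
  have eq: "generate G (X \<union> (Y \<inter> Z)) = generate G (X \<union> Y) \<inter> generate G (X \<union> Z)"
    if "subgroup X G" "subgroup Y G" "subgroup Z G" for X Y Z
    using D that unfolding distributive_def subgroup_join_def by blast
  have "C \<subseteq> generate G (B \<union> C) \<inter> generate G (B \<union> A)"
    using sub by (auto simp: Un_commute intro: generate.incl)
  also have "\<dots> = generate G (B \<union> (C \<inter> A))" using eq[OF B C A] by simp
  finally have "C \<subseteq> generate G ((C \<inter> A) \<union> C) \<inter> generate G ((C \<inter> A) \<union> B)"
    by (auto simp: Un_commute intro: generate.incl)
  then show ?thesis using eq[OF CA C B] by simp
qed

text \<open>The form in which distributivity enters Ore's argument, both for commutativity and for
  cyclicity: the subgroup generated by \<open>a \<otimes> b\<close> lies in the join of those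
  generated by \<open>a\<close> and \<open>b\<close>.\<close>

lemma (in group) mult_mem_join_Int:
  assumes D: "distributive {H. subgroup H G} (subgroup_join G) (\<inter>)"
    and a: "a \<in> carrier G" and b: "b \<in> carrier G"
  shows "a \<otimes> b \<in> generate G ((generate G {a \<otimes> b} \<inter> generate G {a}) \<union> (generate G {a \<otimes> b} \<inter> generate G {b}))"
proof -
  have "subgroup (generate G {x}) G" if "x \<in> carrier G" for x
    using that by (simp add: generate_is_subgroup)
  moreover have "generate G {a \<otimes> b} \<subseteq> generate G (generate G {a} \<union> generate G {b})"
  proof (rule generate_subgroup_incl)
    show "{a \<otimes> b} \<subseteq> generate G (generate G {a} \<union> generate G {b})"
      using mult_mem_generate_Un[of a "generate G {a}" b "generate G {b}"] by (simp add: generate.incl)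
    show "subgroup (generate G (generate G {a} \<union> generate G {b})) G"
      using a b generate_incl by (intro generate_is_subgroup) auto
  qed
  ultimately have "generate G {a \<otimes> b}
      \<subseteq> generate G ((generate G {a \<otimes> b} \<inter> generate G {a}) \<union> (generate G {a \<otimes> b} \<inter> generate G {b}))"
    using a b by (intro distributive_imp_subset_join_Int[OF D]) auto
  then show ?thesis by (auto intro: generate.incl)
qed

lemma (in group) centralizer_subgroup:
  assumes "a \<in> carrier G"
  shows "subgroup {z \<in> carrier G. z \<otimes> a = a \<otimes> z} G"
proof (rule subgroupI)
  fix x assume x: "x \<in> {z \<in> carrier G. z \<otimes> a = a \<otimes> z}"
  then have "inv x \<otimes> (x \<otimes> a) \<otimes> inv x = inv x \<otimes> (a \<otimes> x) \<otimes> inv x" by simp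
  then show "inv x \<in> {z \<in> carrier G. z \<otimes> a = a \<otimes> z}"
    using x assms by (simp add: m_assoc inv_solve_left) (metis inv_closed l_inv l_one m_assoc m_closed r_inv r_one)
next
  fix x y assume "x \<in> {z \<in> carrier G. z \<otimes> a = a \<otimes> z}" "y \<in> {z \<in> carrier G. z \<otimes> a = a \<otimes> z}"
  then show "x \<otimes> y \<in> {z \<in> carrier G. z \<otimes> a = a \<otimes> z}"
    using assms by simp (metis m_assoc)
qed (use assms in auto)

lemma (in group) distributive_imp_comm:
  assumes D: "distributive {H. subgroup H G} (subgroup_join G) (\<inter>)"
  shows "comm_group G"
proof (rule group_comm_groupI)
  fix a b assume a: "a \<in> carrier G" and b: "b \<in> carrier G"
  have powers: "generate G {x} \<subseteq> {z \<in> carrier G. z \<otimes> x = x \<otimes> z}" if "x \<in> carrier G" for x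
    using that centralizer_subgroup by (intro generate_subgroup_incl) auto
  \<comment> \<open>An element of \<open>\<langle>ab\<rangle> \<inter> \<langle>a\<rangle>\<close> commutes with \<open>ab\<close> and \<open>a\<close>, one of \<open>\<langle>ab\<rangle> \<inter> \<langle>b\<rangle>\<close> with
    \<open>ab\<close> and \<open>b\<close>; both commute with \<open>a\<close>.\<close>
  have "(generate G {a \<otimes> b} \<inter> generate G {a}) \<union> (generate G {a \<otimes> b} \<inter> generate G {b})
      \<subseteq> {z \<in> carrier G. z \<otimes> a = a \<otimes> z}"
  proof -
    have "z \<otimes> a = a \<otimes> z"
      if "z \<in> carrier G" "z \<otimes> (a \<otimes> b) = (a \<otimes> b) \<otimes> z" "z \<otimes> b = b \<otimes> z" for z
    proof -
      have "(z \<otimes> a) \<otimes> b = (a \<otimes> z) \<otimes> b" using that a b by (simp add: m_assoc)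
      then show ?thesis using that a b by simp
    qed
    then show ?thesis using powers[OF a] powers[OF b] powers[of "a \<otimes> b"] a b by auto
  qed
  then have "a \<otimes> b \<in> {z \<in> carrier G. z \<otimes> a = a \<otimes> z}"
    using generate_subgroup_incl[OF _ centralizer_subgroup[OF a]] mult_mem_join_Int[OF D a b] by blast
  then have "a \<otimes> (b \<otimes> a) = a \<otimes> (a \<otimes> b)" using a b by (simp add: m_assoc)
  then show "a \<otimes> b = b \<otimes> a" using a b by simp
qed

lemma (in group) mem_generate_singleton_iff:
  assumes "a \<in> carrier G"
  shows "x \<in> generate G {a} \<longleftrightarrow> (\<exists>k::int. x = a [^] k)"
  using generate_pow[OF assms] by auto

text \<open>If \<open>n\<close> is the least positive exponent with \<open>b^n\<close> in
  \<open>A\<close> and \<open>p\<close> is a prime divisor of \<open>n\<close>, then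
  \<open>c = b^(n/p)\<close> works by minimality.\<close>

lemma (in group) prime_power_mem_outside_subgroup:
  assumes fin: "finite (carrier G)" and A: "subgroup A G" and b: "b \<in> carrier G" "b \<notin> A"
  obtains c p where "c \<in> carrier G" "c \<notin> A" "prime (p::nat)" "c [^] p \<in> A"
proof -
  define P where "P = (\<lambda>n::nat. n > 0 \<and> b [^] n \<in> A)"
  define n where "n = (LEAST n. P n)"
  have "P (ord b)"
    unfolding P_def using ord_ge_1[OF fin b(1)] pow_ord_eq_1[OF b(1)] subgroup.one_closed[OF A] by simp
  then have n: "n > 0" "b [^] n \<in> A" unfolding n_def using LeastI[of P] by (auto simp: P_def)
  have "n \<noteq> 1" using n b by auto
  then obtain p where p: "prime p" "p dvd n" using prime_factor_nat by blast
  then obtain q where q: "n = q * p" by (metis dvdE mult.commute)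
  have "q < n" "q > 0" using q n p prime_gt_1_nat by auto
  then have "b [^] q \<notin> A" using not_less_Least[of q P] unfolding n_def P_def by blast
  moreover have "(b [^] q) [^] p \<in> A" using n q b by (simp add: nat_pow_pow)
  ultimately show ?thesis using that[of "b [^] q" p] p b by simp
qed

text \<open>Let \<open>a\<close> generate a cyclic subgroup \<open>A\<close> of maximal order. If
  \<open>A\<close> is proper, some \<open>b\<close> outside it has \<open>b^p = a^k\<close> with
  \<open>p\<close> prime. If \<open>p\<close> does not divide \<open>k\<close>, a single element has
  both \<open>a\<close> and \<open>b\<close> among its powers; if it does, \<open>b\<close> can be
  changed to an \<open>e\<close> of order \<open>p\<close>, and distributivity makes
  \<open>a\<close> a power of \<open>a \<otimes> e\<close>. Both contradict maximality.\<close>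

lemma (in group) finite_distributive_imp_cyclic:
  assumes fin: "finite (carrier G)" and D: "distributive {H. subgroup H G} (subgroup_join G) (\<inter>)"
  shows "cyclic_group G"
proof -
  interpret comm_group G by (rule distributive_imp_comm[OF D])
  obtain a where a: "a \<in> carrier G"
    and a_max: "\<And>x. x \<in> carrier G \<Longrightarrow> card (generate G {x}) \<le> card (generate G {a})"
  proof -
    have "finite ((\<lambda>x. card (generate G {x})) ` carrier G)" using fin by simp
    then show thesis using that Max_in[of "(\<lambda>x. card (generate G {x})) ` carrier G"] Max_ge one_closed
      by (smt (verit) empty_iff imageE imageI)
  qed
  define A where "A = generate G {a}"
  have A: "subgroup A G" and aA: "a \<in> A"
    using a by (auto simp: A_def generate_is_subgroup intro: generate.incl)
  have A_iff: "x \<in> A \<longleftrightarrow> (\<exists>k::int. x = a [^] k)" for x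
    unfolding A_def by (rule mem_generate_singleton_iff[OF a])
  \<comment> \<open>If \<open>a\<close> is a power of \<open>x\<close>, then \<open>A\<close> lies
    in the subgroup generated by \<open>x\<close>, and the choice of \<open>a\<close> forces
    equality.\<close>
  have maximal: "x \<in> A" if x: "x \<in> carrier G" and "a \<in> generate G {x}" for x
  proof -
    have sx: "subgroup (generate G {x}) G" using x by (simp add: generate_is_subgroup)
    have "A \<subseteq> generate G {x}"
      unfolding A_def using that sx by (intro generate_subgroup_incl) auto
    moreover have "finite (generate G {x})" using sx fin subgroup.subset finite_subset by blast
    ultimately have "A = generate G {x}"
      using a_max[OF x] by (intro card_seteq) (auto simp: A_def)
    then show ?thesis by (auto intro: generate.incl)
  qed
  have "carrier G \<subseteq> A"
  proof (rule ccontr)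
    assume "\<not> carrier G \<subseteq> A"
    then obtain b p where b: "b \<in> carrier G" "b \<notin> A" and p: "prime (p::nat)" "b [^] p \<in> A"
      using prime_power_mem_outside_subgroup[OF fin A] by blast
    obtain k :: int where k: "b [^] int p = a [^] k"
      using p(2) A_iff by (auto simp: int_pow_int)
    have bezout: "\<exists>u v. u * int p + v * j = 1" if "\<not> int p dvd j" for j
    proof -
      have "prime (int p)" using p(1) by simp
      then have "gcd (int p) j = 1" using that prime_imp_coprime[of "int p" j] by simp
      then show ?thesis using bezout_int[of "int p" j] by auto
    qed
    show False
    proof (cases "int p dvd k")
      case False
      then obtain u v where uv: "u * int p + v * k = 1" using bezout by blast
      \<comment> \<open>Since \<open>b^p = a^k\<close> and \<open>u p + v k = 1\<close>, this
        element satisfies \<open>c^p = a\<close> and \<open>c^k = b\<close>.\<close>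
      define c where "c = a [^] u \<otimes> b [^] v"
      have c: "c \<in> carrier G" using a b by (simp add: c_def)
      have bk: "b [^] (int p * i) = a [^] (k * i)" for i
        using k a b by (metis int_pow_pow)
      have "c [^] int p = a [^] (u * int p) \<otimes> b [^] (int p * v)"
        unfolding c_def using a b by (simp add: int_pow_distrib int_pow_pow ac_simps)
      also have "\<dots> = a [^] (u * int p + v * k)"
        unfolding bk using a by (simp add: int_pow_mult mult.commute)
      finally have "a = c [^] int p" using uv a by simp
      then have "c \<in> A" using maximal[OF c] mem_generate_singleton_iff[OF c] by blast
      have "c [^] k = a [^] (k * u) \<otimes> b [^] (v * k)"
        unfolding c_def using a b by (simp add: int_pow_distrib int_pow_pow ac_simps)
      also have "\<dots> = b [^] (u * int p + v * k)"
        unfolding bk[symmetric] using b by (simp add: int_pow_mult mult.commute)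
      finally have "b = c [^] k" using uv b by simp
      then show False using \<open>c \<in> A\<close> b A by (simp add: subgroup_int_pow_closed)
    next
      case True
      then obtain m where m: "k = int p * m" by blast
      \<comment> \<open>Dividing \<open>b\<close> by \<open>a^m\<close>, a \<open>p\<close>-th root
        of \<open>b^p\<close> inside \<open>A\<close>, leaves an element with trivial
        \<open>p\<close>-th power that is still outside \<open>A\<close>.\<close>
      define e where "e = b \<otimes> a [^] (- m)"
      have e: "e \<in> carrier G" using a b by (simp add: e_def)
      have "e [^] int p = b [^] int p \<otimes> a [^] (- k)"
        unfolding e_def m using a b by (simp add: int_pow_distrib int_pow_pow ac_simps)
      then have ep: "e [^] int p = \<one>"
        unfolding k using a by (simp add: int_pow_mult[symmetric])
      have "b = e \<otimes> a [^] m"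
        unfolding e_def using a b by (simp add: m_assoc int_pow_mult[symmetric])
      then have eA: "e \<notin> A" using b A aA by (metis subgroup.m_closed subgroup_int_pow_closed)
      have aeA: "a \<otimes> e \<notin> A"
      proof
        assume "a \<otimes> e \<in> A"
        then have "inv a \<otimes> (a \<otimes> e) \<in> A" using A aA by (simp add: subgroup.m_closed subgroup.m_inv_closed)
        then show False using eA a e by (simp add: m_assoc[symmetric])
      qed
      define C where "C = generate G {a \<otimes> e}"
      have C: "subgroup C G" using a e by (simp add: C_def generate_is_subgroup)
      \<comment> \<open>Otherwise both intersections in \<open>mult_mem_join_Int\<close> would lie
        in \<open>A\<close>, and so would \<open>a \<otimes> e\<close>.\<close>
      have "\<not> C \<inter> generate G {e} \<subseteq> A"
      proof
        assume "C \<inter> generate G {e} \<subseteq> A"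
        then have "generate G ((C \<inter> A) \<union> (C \<inter> generate G {e})) \<subseteq> A"
          using A by (intro generate_subgroup_incl) auto
        then show False using mult_mem_join_Int[OF D a e] aeA by (auto simp: C_def A_def)
      qed
      then obtain y where y: "y \<in> C" "y \<in> generate G {e}" "y \<notin> A" by blast
      obtain j :: int where "y = e [^] j" using y(2) mem_generate_singleton_iff[OF e] by blast
      then have j: "e [^] j \<in> C" "e [^] j \<notin> A" using y by simp_all
      have "\<not> int p dvd j"
      proof
        assume "int p dvd j"
        then obtain i where "j = int p * i" by blast
        then have "e [^] j = \<one>" using ep e by (metis int_pow_one int_pow_pow)
        then show False using j(2) A by (simp add: subgroup.one_closed)
      qed
      \<comment> \<open>As \<open>e^p\<close> is trivial and \<open>j\<close> is prime to
        \<open>p\<close>, \<open>e\<close> is a power of \<open>e^j\<close> and hence lies in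
        \<open>C\<close>.\<close>
      then obtain u v where uv: "u * int p + v * j = 1" using bezout by blast
      have "e = e [^] (int p * u + j * v)" using uv e by (simp add: ac_simps)
      also have "\<dots> = (e [^] int p) [^] u \<otimes> (e [^] j) [^] v"
        using e by (simp add: int_pow_mult int_pow_pow)
      also have "\<dots> = (e [^] j) [^] v" using ep e by simp
      finally have "e \<in> C" using j(1) C by (metis subgroup_int_pow_closed)
      moreover have "a \<otimes> e \<in> C" by (auto simp: C_def intro: generate.incl)
      ultimately have "(a \<otimes> e) \<otimes> inv e \<in> C" using C by (simp add: subgroup.m_closed subgroup.m_inv_closed)
      then have "a \<in> C" using a e by (simp add: m_assoc)
      then show False using maximal[of "a \<otimes> e"] aeA a e by (simp add: C_def)
    qed
  qed
  then have "carrier G = range (\<lambda>k::int. a [^] k)"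
    using A_iff subgroup.subset[OF A] by (intro equalityI) blast+
  then show ?thesis using cyclic_group a by blast
qed


section \<open>Open subgroups of profinite groups\<close>

text \<open>Directedness puts a single \<open>C k\<close> below any finite subfamily, so the finite
  intersection property applies. This turns choices made at each finite level into one choice valid
  at all levels.\<close>

lemma compact_space_directed_Inter:
  assumes X: "compact_space X" and I: "I \<noteq> {}"
    and closed: "\<And>i. i \<in> I \<Longrightarrow> closedin X (C i)" and ne: "\<And>i. i \<in> I \<Longrightarrow> C i \<noteq> {}"
    and directed: "\<And>i j. i \<in> I \<Longrightarrow> j \<in> I \<Longrightarrow> \<exists>k\<in>I. C k \<subseteq> C i \<inter> C j"
  obtains x where "\<And>i. i \<in> I \<Longrightarrow> x \<in> C i"
proof -
  have "\<exists>k\<in>I. C k \<subseteq> \<Inter>F" if "finite F" "F \<subseteq> C ` I" for F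
    using that
  proof (induction F rule: finite_induct)
    case empty
    then show ?case using I by auto
  next
    case (insert A F)
    then obtain i k where "i \<in> I" "A = C i" "k \<in> I" "C k \<subseteq> \<Inter>F" by auto
    then show ?case using directed[of i k] by auto
  qed
  then have "\<Inter>F \<noteq> {}" if "finite F" "F \<subseteq> C ` I" for F
    using that ne by (metis subset_empty)
  then have "\<Inter>(C ` I) \<noteq> {}"
    using X[unfolded compact_space_fip, rule_format, of "C ` I"] closed by blast
  then show ?thesis using that by blast
qed

section \<open>Open subgroups and cosets in topological groups\<close>

context topological_group
begin

lemma continuous_map_group_mult:
  assumes "continuous_map X T f" "continuous_map X T g"
  shows "continuous_map X T (\<lambda>x. f x \<otimes> g x)"
  using continuous_map_compose[OF continuous_map_pairedI[OF assms] continuous_mult]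
  by (simp add: comp_def)

lemma continuous_map_const_mult:
  assumes "a \<in> carrier G"
  shows "continuous_map T T (\<lambda>x. x \<otimes> a)" "continuous_map T T (\<lambda>x. a \<otimes> x)"
  using assms topspace_eq by (auto intro!: continuous_map_group_mult)

text \<open>Around each \<open>x\<close> in \<open>U\<close> the translate of \<open>N\<close> by
  \<open>x\<close> is a neighbourhood inside \<open>U\<close>; it is open as the preimage of
  \<open>N\<close> under right multiplication by \<open>inv x\<close>.\<close>

lemma openin_union_of_cosets:
  assumes N: "openin T N" "\<one> \<in> N" and U: "U \<subseteq> carrier G"
    and closed: "\<And>n x. n \<in> N \<Longrightarrow> x \<in> U \<Longrightarrow> n \<otimes> x \<in> U"
  shows "openin T U"
proof (subst openin_subopen, rule ballI)
  fix x assume x: "x \<in> U"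
  then have xc: "x \<in> carrier G" using U by blast
  let ?V = "{y \<in> topspace T. y \<otimes> inv x \<in> N}"
  have "openin T ?V"
    using continuous_map_const_mult(1)[of "inv x"] N(1) xc by (simp add: openin_continuous_map_preimage)
  moreover have "x \<in> ?V" using xc N by (simp add: topspace_eq)
  moreover have "?V \<subseteq> U"
  proof
    fix y assume y: "y \<in> ?V"
    then have "y = (y \<otimes> inv x) \<otimes> x" using xc by (simp add: topspace_eq m_assoc)
    then show "y \<in> U" using closed[OF _ x] y by (metis (no_types, lifting) mem_Collect_eq)
  qed
  ultimately show "\<exists>V. openin T V \<and> x \<in> V \<and> V \<subseteq> U" by blast
qed

lemma openin_supergroup:
  assumes "openin T N" "\<one> \<in> N" "N \<subseteq> J" "subgroup J G"
  shows "openin T J"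
  using assms by (intro openin_union_of_cosets[of N J]) (auto simp: subgroup.m_closed dest: subgroup.subset)

text \<open>The complement is stable under left multiplication by \<open>N\<close>, hence open by
  \<open>openin_union_of_cosets\<close>.\<close>

lemma closedin_open_subgroup:
  assumes N: "subgroup N G" "openin T N"
  shows "closedin T N"
proof -
  have "openin T (carrier G - N)"
  proof (rule openin_union_of_cosets[OF N(2) subgroup.one_closed[OF N(1)]])
    fix n x assume nx: "n \<in> N" "x \<in> carrier G - N"
    have nc: "n \<in> carrier G" using nx N by (simp add: subgroup.mem_carrier)
    have "x \<in> N" if "n \<otimes> x \<in> N"
    proof -
      have "inv n \<otimes> (n \<otimes> x) \<in> N" using that nx N by (simp add: subgroup.m_closed subgroup.m_inv_closed)
      then show ?thesis using nx nc by (simp add: m_assoc[symmetric])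
    qed
    then show "n \<otimes> x \<in> carrier G - N" using nx nc by auto
  qed auto
  then show ?thesis
    using N by (simp add: closedin_def topspace_eq subgroup.subset)
qed

lemma r_coset_mult_left:
  assumes "subgroup N G" "n \<in> N" "x \<in> carrier G"
  shows "N #> (n \<otimes> x) = N #> x"
  using assms by (metis rcosI repr_independence subgroup.subset)

lemma continuous_map_r_coset:
  assumes N: "N \<lhd> G" "openin T N"
  shows "continuous_map T (discrete_topology (carrier (G Mod N))) (\<lambda>x. N #> x)"
proof -
  have sub: "subgroup N G" using N(1) by (rule normal_imp_subgroup)
  have "openin T {x \<in> carrier G. N #> x \<in> U}" for U
    using r_coset_mult_left[OF sub] subgroup.one_closed[OF sub] subgroup.mem_carrier[OF sub]
    by (intro openin_union_of_cosets[OF N(2)]) auto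
  then show ?thesis
    by (auto simp: continuous_map_def topspace_eq carrier_FactGroup)
qed

text \<open>Open subgroups are closed, and a join with an open subgroup is open, hence already
  closed. Taking closures changes nothing there, so the law restricts.\<close>

lemma distributive_open_if_closed:
  assumes D: "distributive (closed_subgroups G T) (closed_subgroup_join G T) (\<inter>)"
  shows "distributive (open_subgroups G T) (subgroup_join G) (\<inter>)"
proof -
  have closed: "X \<in> closed_subgroups G T" if "X \<in> open_subgroups G T" for X
    using that closedin_open_subgroup by (auto simp: open_subgroups_def closed_subgroups_def)
  have join: "closed_subgroup_join G T X Y = subgroup_join G X Y"
    if X: "X \<in> open_subgroups G T" and Y: "subgroup Y G" for X Y
  proof -
    have X': "subgroup X G" "openin T X" using X by (auto simp: open_subgroups_def)
    have sub: "subgroup (generate G (X \<union> Y)) G"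
      using X' Y by (intro generate_is_subgroup) (auto dest: subgroup.mem_carrier)
    have "openin T (generate G (X \<union> Y))"
    proof (rule openin_supergroup[OF X'(2) subgroup.one_closed[OF X'(1)] _ sub])
      show "X \<subseteq> generate G (X \<union> Y)" by (auto intro: generate.incl)
    qed
    then show ?thesis
      unfolding closed_subgroup_join_def subgroup_join_def
      using closedin_open_subgroup[OF sub] by (simp add: closure_of_closedin)
  qed
  show ?thesis
    unfolding distributive_def
  proof (intro ballI)
    fix X Y Z assume XYZ: "X \<in> open_subgroups G T" "Y \<in> open_subgroups G T" "Z \<in> open_subgroups G T"
    have "subgroup (Y \<inter> Z) G" "subgroup Y G" "subgroup Z G"
      using XYZ by (auto simp: open_subgroups_def subgroups_Inter_pair)
    then show "subgroup_join G X (Y \<inter> Z) = subgroup_join G X Y \<inter> subgroup_join G X Z"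
      using D[unfolded distributive_def, rule_format, OF closed[OF XYZ(1)] closed[OF XYZ(2)] closed[OF XYZ(3)]]
        join[OF XYZ(1)] by simp
  qed
qed

end

text \<open>The contexts \<open>a\<close> and \<open>b\<close> on both sides absorb inverses, second
  factors and conjugating elements; this yields a subgroup and its normality at once.\<close>

lemma (in group) two_sided_stabilizer_normal:
  "{g \<in> carrier G. \<forall>a\<in>carrier G. \<forall>b\<in>carrier G. a \<otimes> g \<otimes> b \<in> U \<longleftrightarrow> a \<otimes> b \<in> U} \<lhd> G" (is "?N \<lhd> G")
proof (rule normal_invI)
  have N: "g \<in> ?N \<longleftrightarrow> g \<in> carrier G \<and> (\<forall>a\<in>carrier G. \<forall>b\<in>carrier G. a \<otimes> g \<otimes> b \<in> U \<longleftrightarrow> a \<otimes> b \<in> U)" for g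
    by simp
  show "subgroup ?N G"
  proof (rule subgroupI)
    fix g assume g: "g \<in> ?N"
    have "a \<otimes> inv g \<otimes> b \<in> U \<longleftrightarrow> a \<otimes> b \<in> U" if ab: "a \<in> carrier G" "b \<in> carrier G" for a b
    proof -
      have "a \<otimes> inv g \<in> carrier G" using g ab by simp
      then have "(a \<otimes> inv g) \<otimes> g \<otimes> b \<in> U \<longleftrightarrow> (a \<otimes> inv g) \<otimes> b \<in> U"
        using g ab unfolding N by blast
      then show ?thesis using g ab by (simp add: m_assoc)
    qed
    then show "inv g \<in> ?N" using g by auto
  next
    fix g h assume g: "g \<in> ?N" and h: "h \<in> ?N"
    have "a \<otimes> (g \<otimes> h) \<otimes> b \<in> U \<longleftrightarrow> a \<otimes> b \<in> U" if ab: "a \<in> carrier G" "b \<in> carrier G" for a b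
    proof -
      have "a \<otimes> g \<otimes> (h \<otimes> b) \<in> U \<longleftrightarrow> a \<otimes> (h \<otimes> b) \<in> U" "a \<otimes> h \<otimes> b \<in> U \<longleftrightarrow> a \<otimes> b \<in> U"
        using g h ab unfolding N by auto
      then show ?thesis using g h ab by (simp add: m_assoc)
    qed
    then show "g \<otimes> h \<in> ?N" using g h by auto
  qed (auto intro!: exI[of _ \<one>])
  fix x g assume x: "x \<in> carrier G" and g: "g \<in> ?N"
  have "a \<otimes> (x \<otimes> g \<otimes> inv x) \<otimes> b \<in> U \<longleftrightarrow> a \<otimes> b \<in> U" if ab: "a \<in> carrier G" "b \<in> carrier G" for a b
  proof -
    have "a \<otimes> x \<in> carrier G" "inv x \<otimes> b \<in> carrier G" using x ab by auto
    then have "(a \<otimes> x) \<otimes> g \<otimes> (inv x \<otimes> b) \<in> U \<longleftrightarrow> (a \<otimes> x) \<otimes> (inv x \<otimes> b) \<in> U"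
      using g unfolding N by blast
    moreover have "(a \<otimes> x) \<otimes> (inv x \<otimes> b) = a \<otimes> (x \<otimes> inv x) \<otimes> b"
      using x ab by (simp only: m_assoc m_closed inv_closed)
    ultimately show ?thesis using x g ab by (simp add: m_assoc)
  qed
  then show "x \<otimes> g \<otimes> inv x \<in> ?N" using x g by auto
qed

section \<open>Profinite groups, their finite quotients and their subgroup lattices\<close>

context profinite_group
begin

text \<open>Components are points, so no connected set contains both \<open>x\<close> and
  \<open>y\<close>; the cut wire fence theorem for compact Hausdorff spaces then separates
  them.\<close>

lemma clopen_separation:
  assumes x: "x \<in> topspace T" and y: "y \<in> topspace T" and "x \<noteq> y"
  obtains U where "openin T U" "closedin T U" "x \<in> U" "y \<notin> U"
proof -
  have "\<not> connected_component_of T x y"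
    using totally_disconnected[OF x] \<open>x \<noteq> y\<close> by (metis mem_Collect_eq singletonD)
  then have "disjnt C {x} \<or> disjnt C {y}" if "connectedin T C" for C
    using that by (auto simp: connected_component_of_def disjnt_iff)
  then have "separated_between T {x} {y}"
    using x y compact Hausdorff
    by (intro cut_wire_fence_theorem) (auto simp: closedin_Hausdorff_singleton)
  then show ?thesis using that by (auto simp: separated_between)
qed

text \<open>The subgroup is the two-sided stabilizer of a clopen \<open>U\<close> that contains
  \<open>\<one>\<close> but not \<open>x\<close>; the context \<open>a = b = \<one>\<close> shows
  that it omits \<open>x\<close>.\<close>

lemma open_normal_subgroup_separation:
  assumes x: "x \<in> carrier G" "x \<noteq> \<one>"
  obtains N where "N \<lhd> G" "openin T N" "x \<notin> N"
proof -
  obtain U where U: "openin T U" "closedin T U" "\<one> \<in> U" "x \<notin> U"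
    using clopen_separation[of \<one> x] x by (auto simp: topspace_eq)
  let ?N = "{g \<in> carrier G. \<forall>a\<in>carrier G. \<forall>b\<in>carrier G. a \<otimes> g \<otimes> b \<in> U \<longleftrightarrow> a \<otimes> b \<in> U}"
  let ?P = "prod_topology T (prod_topology T T)"
  let ?agb = "\<lambda>z. fst (snd z) \<otimes> fst z \<otimes> snd (snd z)" and ?ab = "\<lambda>z. fst (snd z) \<otimes> snd (snd z)"
  have proj: "continuous_map ?P T fst" "continuous_map ?P T (\<lambda>z. fst (snd z))" "continuous_map ?P T (\<lambda>z. snd (snd z))"
    using continuous_map_compose[OF continuous_map_snd continuous_map_fst, of T T T]
      continuous_map_compose[OF continuous_map_snd continuous_map_snd, of T T T]
    by (auto simp: comp_def continuous_map_fst)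
  then have cont: "continuous_map ?P T ?agb" "continuous_map ?P T ?ab"
    by (auto intro!: continuous_map_group_mult)
  \<comment> \<open>The triples \<open>(g, (a, b))\<close> for which \<open>g\<close> changes
    membership in \<open>U\<close>. They form a closed set because \<open>U\<close> is clopen. The
    complement of \<open>?N\<close> is its projection to the first factor, closed since the other
    two factors are compact.\<close>
  let ?W = "{z \<in> topspace ?P. ?agb z \<in> U \<longleftrightarrow> ?ab z \<notin> U}"
  have "closedin ?P (({z \<in> topspace ?P. ?agb z \<in> U} \<inter> {z \<in> topspace ?P. ?ab z \<in> topspace T - U})
      \<union> ({z \<in> topspace ?P. ?agb z \<in> topspace T - U} \<inter> {z \<in> topspace ?P. ?ab z \<in> U}))"
    using U cont by (intro closedin_Un closedin_Int closedin_continuous_map_preimage) auto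
  also have "(({z \<in> topspace ?P. ?agb z \<in> U} \<inter> {z \<in> topspace ?P. ?ab z \<in> topspace T - U})
      \<union> ({z \<in> topspace ?P. ?agb z \<in> topspace T - U} \<inter> {z \<in> topspace ?P. ?ab z \<in> U})) = ?W"
    by (auto simp: topspace_eq)
  finally have "closedin ?P ?W" .
  moreover have "compact_space (prod_topology T T)"
    using compact by (simp add: compact_space_prod_topology)
  ultimately have "closedin T (fst ` ?W)"
    using Abstract_Topological_Spaces.closed_map_fst[of "prod_topology T T" T] by (simp add: closed_map_def)
  moreover have "?N = topspace T - fst ` ?W"
    by (force simp: topspace_eq image_iff)
  ultimately have "openin T ?N" by auto
  moreover have "x \<notin> ?N"
  proof
    assume "x \<in> ?N"
    then have "\<one> \<otimes> x \<otimes> \<one> \<in> U \<longleftrightarrow> \<one> \<otimes> \<one> \<in> U" by blast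
    then show False using U x by simp
  qed
  ultimately show ?thesis using that two_sided_stabilizer_normal by blast
qed

text \<open>The quotient is a continuous image of a compact space, and a compact discrete space is
  finite.\<close>

lemma finite_open_quotient:
  assumes "N \<lhd> G" "openin T N"
  shows "finite (carrier (G Mod N))"
  using image_compactin[OF compact[unfolded compact_space_def] continuous_map_r_coset[OF assms]]
  by (simp add: compactin_discrete_topology carrier_FactGroup topspace_eq)

text \<open>Preimages under the quotient map embed the subgroups of the quotient into the open
  subgroups of \<open>G\<close>, preserving meets and joins.\<close>

lemma distributive_quotient:
  assumes D: "distributive (open_subgroups G T) (subgroup_join G) (\<inter>)"
    and N: "N \<lhd> G" "openin T N"
  shows "distributive {H. subgroup H (G Mod N)} (subgroup_join (G Mod N)) (\<inter>)"
proof -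
  let ?q = "\<lambda>x. N #> x"
  interpret Q: group "G Mod N" by (rule normal.factorgroup_is_group[OF N(1)])
  interpret q: group_hom G "G Mod N" ?q
    using normal.r_coset_hom_Mod[OF N(1)] by (simp add: group_hom_def group_hom_axioms_def Q.group_axioms group_axioms)
  have sub: "subgroup N G" using N(1) by (rule normal_imp_subgroup)
  define P where "P = (\<lambda>S. {x \<in> carrier G. ?q x \<in> S})"
  have qP: "?q ` P S = S" if "subgroup S (G Mod N)" for S
    using subgroup.subset[OF that] by (auto simp: P_def carrier_FactGroup)
  have P_open: "P S \<in> open_subgroups G T" if S: "subgroup S (G Mod N)" for S
  proof -
    have "subgroup (P S) G"
      using S by (intro subgroupI)
        (auto simp: P_def subgroup.m_closed subgroup.m_inv_closed subgroup.one_closed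
          simp del: mult_FactGroup one_FactGroup intro!: exI[of _ \<one>])
    moreover have "openin T (P S)"
      using openin_continuous_map_preimage[OF continuous_map_r_coset[OF N], of S] subgroup.subset[OF S]
      by (simp add: P_def topspace_eq)
    ultimately show ?thesis by (simp add: open_subgroups_def)
  qed
  have join: "P (generate (G Mod N) (S \<union> S')) = generate G (P S \<union> P S')"
    if S: "subgroup S (G Mod N)" "subgroup S' (G Mod N)" for S S'
  proof -
    let ?J = "generate G (P S \<union> P S')"
    have PG: "P S \<union> P S' \<subseteq> carrier G" by (auto simp: P_def)
    have J: "subgroup ?J G" using PG by (rule generate_is_subgroup)
    have "generate (G Mod N) (S \<union> S') = ?q ` ?J"
      using q.generate_img[OF PG] qP S by (simp add: image_Un)
    \<comment> \<open>\<open>?J\<close> contains \<open>N\<close>, so it is a union of cosets and is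
      recovered from its image.\<close>
    moreover have "P (?q ` ?J) = ?J"
    proof
      show "?J \<subseteq> P (?q ` ?J)" using subgroup.subset[OF J] by (auto simp: P_def)
      show "P (?q ` ?J) \<subseteq> ?J"
      proof
        fix x assume "x \<in> P (?q ` ?J)"
        then obtain y where x: "x \<in> carrier G" and y: "y \<in> ?J" "N #> x = N #> y" by (auto simp: P_def)
        then have "x \<in> N #> y" using rcos_self[OF x sub] by simp
        then obtain n where n: "n \<in> N" "x = n \<otimes> y" by (auto simp: r_coset_def)
        have "n \<in> P S"
          using n sub S by (auto simp: P_def subgroup.mem_carrier coset_join2 dest: subgroup.one_closed)
        then show "x \<in> ?J" using n y J by (auto intro: subgroup.m_closed generate.incl)
      qed
    qed
    ultimately show ?thesis by simp
  qed
  have "generate (G Mod N) (S \<union> (S' \<inter> S'')) = generate (G Mod N) (S \<union> S') \<inter> generate (G Mod N) (S \<union> S'')"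
    (is "?L = ?R") if S: "subgroup S (G Mod N)" "subgroup S' (G Mod N)" "subgroup S'' (G Mod N)" for S S' S''
  proof -
    have Int: "subgroup (S' \<inter> S'') (G Mod N)" using S by (simp add: Q.subgroups_Inter_pair)
    have P_Int: "P (A \<inter> B) = P A \<inter> P B" for A B by (auto simp: P_def)
    have gen: "subgroup (generate (G Mod N) (A \<union> B)) (G Mod N)"
      if "subgroup A (G Mod N)" "subgroup B (G Mod N)" for A B
      using that by (intro Q.generate_is_subgroup) (auto dest: subgroup.subset)
    have "P ?L = P ?R"
      using D[unfolded distributive_def subgroup_join_def, rule_format, OF P_open[OF S(1)] P_open[OF S(2)] P_open[OF S(3)]]
      by (simp only: P_Int join S Int)
    then show ?thesis
      using qP[of ?L] qP[of ?R] gen S Int by (metis Q.subgroups_Inter_pair)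
  qed
  then show ?thesis by (simp add: distributive_def subgroup_join_def)
qed

text \<open>Send \<open>x\<close> to the family of its cosets modulo all open normal subgroups. This
  is injective by \<open>open_normal_subgroup_separation\<close> and surjective by compactness, and
  a continuous bijection from a compact space to a Hausdorff space is a homeomorphism.\<close>

lemma procyclic_if_open_quotients_cyclic:
  assumes cyc: "\<And>N. N \<lhd> G \<Longrightarrow> openin T N \<Longrightarrow> cyclic_group (G Mod N)"
  shows "procyclic G T"
proof -
  define J where "J = {N. N \<lhd> G \<and> openin T N}"
  define s where "s = {(M, N). M \<in> J \<and> N \<in> J \<and> N \<subseteq> M}"
  \<comment> \<open>For \<open>N\<close> inside \<open>M\<close>, multiplication by \<open>M\<close>
    enlarges a coset of \<open>N\<close> to the coset of \<open>M\<close> around it.\<close>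
  define \<psi> where "\<psi> = (\<lambda>M (N :: 'a set) C. M <#> C)"
  have J: "N \<lhd> G" "openin T N" "subgroup N G" if "N \<in> J" for N
    using that normal_imp_subgroup by (auto simp: J_def)
  have J_Int: "M \<inter> N \<in> J" if "M \<in> J" "N \<in> J" for M N
    using that by (auto simp: J_def normal_subgroup_intersect)
  have "carrier G \<in> J"
    using topspace_eq openin_topspace[of T] by (auto simp: J_def intro!: normal_invI subgroup_self)
  then have J_ne: "J \<noteq> {}" by blast
  have \<psi>_coset: "\<psi> M N (N #> x) = M #> x" if MN: "(M, N) \<in> s" and x: "x \<in> carrier G" for M N x
  proof -
    have M: "subgroup M G" and N: "subgroup N G" and sub: "N \<subseteq> M" using MN J by (auto simp: s_def)
    have "m \<otimes> n \<in> M" if "m \<in> M" "n \<in> N" for m n using that sub M by (auto simp: subgroup.m_closed)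
    moreover have "m \<in> M <#> N" if "m \<in> M" for m
    proof -
      have "m \<otimes> \<one> \<in> M <#> N"
        unfolding set_mult_def using that subgroup.one_closed[OF N] by blast
      then show ?thesis using that M by (simp add: subgroup.mem_carrier)
    qed
    ultimately have "M <#> N = M" by (auto simp: set_mult_def)
    then show ?thesis
      using setmult_rcos_assoc[of M N x] M N x by (simp add: \<psi>_def subgroup.subset)
  qed
  have sys: "inverse_system J s (\<lambda>N. G Mod N) \<psi>"
  proof (rule inverse_system.intro)
    show "partial_order_on J s"
      by (auto simp: s_def order_on_defs refl_on_def trans_def antisym_def)
    show "J \<noteq> {}" by (rule J_ne)
    show "\<exists>K\<in>J. (M, K) \<in> s \<and> (N, K) \<in> s" if "M \<in> J" "N \<in> J" for M N
      using that J_Int by (auto simp: s_def intro!: bexI[of _ "M \<inter> N"])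
    show "group (G Mod N)" if "N \<in> J" for N
      using J[OF that] by (simp add: normal.factorgroup_is_group)
    show "\<psi> M N \<in> hom (G Mod N) (G Mod M)" if MN: "(M, N) \<in> s" for M N
    proof (rule homI)
      have MNJ: "M \<in> J" "N \<in> J" using MN by (auto simp: s_def)
      show "\<psi> M N C \<in> carrier (G Mod M)" if "C \<in> carrier (G Mod N)" for C
        using that \<psi>_coset[OF MN] by (auto simp: carrier_FactGroup)
      show "\<psi> M N (C \<otimes>\<^bsub>G Mod N\<^esub> D) = \<psi> M N C \<otimes>\<^bsub>G Mod M\<^esub> \<psi> M N D"
        if "C \<in> carrier (G Mod N)" "D \<in> carrier (G Mod N)" for C D
        using that MNJ
        by (auto simp: carrier_FactGroup \<psi>_coset[OF MN] normal.rcos_sum[OF J(1)])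
    qed
    show "\<psi> N N C = C" if "N \<in> J" "C \<in> carrier (G Mod N)" for N C
      using that \<psi>_coset[of N N] by (auto simp: carrier_FactGroup s_def)
    show "\<psi> L M (\<psi> M N C) = \<psi> L N C" if "(L, M) \<in> s" "(M, N) \<in> s" "C \<in> carrier (G Mod N)" for L M N C
    proof -
      have "(L, N) \<in> s" using that by (auto simp: s_def)
      then show ?thesis using that by (auto simp: carrier_FactGroup \<psi>_coset)
    qed
  qed
  define K where "K = inverse_limit_carrier J s (\<lambda>N. G Mod N) \<psi>"
  define U where "U = inverse_limit_topology J s (\<lambda>N. G Mod N) \<psi>"
  define f where "f = (\<lambda>x. \<lambda>N\<in>J. N #> x)"
  have top_U: "topspace U = K"
    unfolding U_def K_def inverse_limit_topology_def by (auto simp: inverse_limit_carrier_def)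
  have fK: "f x \<in> K" if "x \<in> carrier G" for x
    using that \<psi>_coset
    by (auto simp: K_def f_def inverse_limit_carrier_def carrier_FactGroup) (auto simp: s_def)
  have f_cont: "continuous_map T U f"
  proof -
    have "continuous_map T (discrete_topology (carrier (G Mod N))) (\<lambda>x. f x N)" if "N \<in> J" for N
      using continuous_map_r_coset[OF J(1,2)[OF that]] that by (simp add: f_def)
    then have "continuous_map T (product_topology (\<lambda>N. discrete_topology (carrier (G Mod N))) J) f"
      unfolding continuous_map_componentwise by (auto simp: f_def)
    then show ?thesis
      unfolding U_def inverse_limit_topology_def continuous_map_in_subtopology
      using fK by (auto simp: topspace_eq K_def)
  qed
  have f_inj: "inj_on f (carrier G)"
  proof (rule inj_onI)
    fix x y assume xy: "x \<in> carrier G" "y \<in> carrier G" "f x = f y"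
    have "x \<otimes> inv y \<in> N" if N: "N \<in> J" for N
    proof -
      have "N #> x = N #> y" using xy(3) N by (auto simp: f_def dest: fun_cong[of _ _ N])
      then have "x \<in> N #> y" using rcos_self[OF xy(1) J(3)[OF N]] by simp
      then show ?thesis using subgroup.rcos_module_imp[OF J(3)[OF N] is_group xy(2)] by blast
    qed
    then have "x \<otimes> inv y = \<one>"
      using open_normal_subgroup_separation[of "x \<otimes> inv y"] xy by (auto simp: J_def)
    then show "x = y" using xy by (metis inv_equality inv_closed inv_inv)
  qed
  have f_surj: "f ` carrier G = K"
  proof
    show "f ` carrier G \<subseteq> K" using fK by blast
    show "K \<subseteq> f ` carrier G"
    proof
      fix c assume c: "c \<in> K"
      then have c_carrier: "c N \<in> carrier (G Mod N)" if "N \<in> J" for N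
        using that by (auto simp: K_def inverse_limit_carrier_def PiE_iff)
      have c_\<psi>: "\<psi> M N (c N) = c M" if "(M, N) \<in> s" for M N
        using c that by (auto simp: K_def inverse_limit_carrier_def)
      \<comment> \<open>The fibres over the components of \<open>c\<close> are closed and nonempty,
        and the fibre for \<open>M \<inter> N\<close> lies in those for \<open>M\<close> and
        \<open>N\<close>; a common point is a preimage of \<open>c\<close>.\<close>
      obtain x where x: "\<And>N. N \<in> J \<Longrightarrow> x \<in> {x \<in> topspace T. N #> x \<in> {c N}}"
      proof (rule compact_space_directed_Inter[OF compact J_ne, of "\<lambda>N. {x \<in> topspace T. N #> x \<in> {c N}}"])
        fix N assume N: "N \<in> J"
        show "closedin T {x \<in> topspace T. N #> x \<in> {c N}}"
          using c_carrier[OF N]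
          by (intro closedin_continuous_map_preimage[OF continuous_map_r_coset[OF J(1,2)[OF N]]]) auto
        show "{x \<in> topspace T. N #> x \<in> {c N}} \<noteq> {}"
          using c_carrier[OF N] by (auto simp: carrier_FactGroup topspace_eq)
      next
        fix M N assume MN: "M \<in> J" "N \<in> J"
        then have s: "(M, M \<inter> N) \<in> s" "(N, M \<inter> N) \<in> s" using J_Int by (auto simp: s_def)
        have "M #> x = c M \<and> N #> x = c N" if "x \<in> carrier G" "(M \<inter> N) #> x = c (M \<inter> N)" for x
          using \<psi>_coset[OF s(1) that(1)] \<psi>_coset[OF s(2) that(1)] c_\<psi>[OF s(1)] c_\<psi>[OF s(2)] that(2) by simp
        then show "\<exists>L\<in>J. {x \<in> topspace T. L #> x \<in> {c L}}
            \<subseteq> {x \<in> topspace T. M #> x \<in> {c M}} \<inter> {x \<in> topspace T. N #> x \<in> {c N}}"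
          using J_Int[OF MN] by (intro bexI[of _ "M \<inter> N"]) (auto simp: topspace_eq)
      qed (use that in blast)
      have "f x = c"
      proof
        fix N
        show "f x N = c N"
          using x[of N] c by (cases "N \<in> J")
            (auto simp: f_def K_def inverse_limit_carrier_def PiE_def extensional_def)
      qed
      moreover have "x \<in> carrier G" using x J_ne by (auto simp: topspace_eq)
      ultimately show "c \<in> f ` carrier G" by blast
    qed
  qed
  have "Hausdorff_space U"
    unfolding U_def inverse_limit_topology_def
    by (simp add: Hausdorff_space_subtopology Hausdorff_space_product_topology Hausdorff_space_discrete_topology)
  then have homeo: "homeomorphic_map T U f"
    using f_cont compact f_surj f_inj
    by (intro continuous_imp_homeomorphic_map) (auto simp: topspace_eq top_U)
  have "f \<in> hom G (inverse_limit_group J s (\<lambda>N. G Mod N) \<psi>)"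
  proof (rule homI)
    show "f x \<in> carrier (inverse_limit_group J s (\<lambda>N. G Mod N) \<psi>)" if "x \<in> carrier G" for x
      using fK[OF that] by (simp add: inverse_limit_group_def K_def)
    show "f (x \<otimes> y) = f x \<otimes>\<^bsub>inverse_limit_group J s (\<lambda>N. G Mod N) \<psi>\<^esub> f y"
      if "x \<in> carrier G" "y \<in> carrier G" for x y
      using that by (auto simp: inverse_limit_group_def f_def normal.rcos_sum[OF J(1)] intro!: restrict_ext)
  qed
  then have "topological_group_iso G T (inverse_limit_group J s (\<lambda>N. G Mod N) \<psi>) U f"
    using homeo f_inj f_surj
    by (simp add: topological_group_iso_def iso_def bij_betw_def inverse_limit_group_def K_def)
  then show ?thesis
    unfolding procyclic_def U_def
    using sys cyc finite_open_quotient J by blast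
qed

text \<open>For \<open>x\<close> in both joins, the aim is an \<open>a\<close> in \<open>X\<close>
  with \<open>inv a \<otimes> x\<close> in \<open>Y \<inter> Z\<close>. The law for finite cyclic
  groups gives an approximate \<open>a\<close> at each level, and compactness an exact one.\<close>

lemma distributive_closed_if_cyclic_quotients:
  fixes H :: "'i \<Rightarrow> 'h monoid" and p :: "'i \<Rightarrow> 'a \<Rightarrow> 'h"
  assumes I: "I \<noteq> {}"
    and H: "\<And>i. i \<in> I \<Longrightarrow> group (H i)" "\<And>i. i \<in> I \<Longrightarrow> cyclic_group (H i)" "\<And>i. i \<in> I \<Longrightarrow> finite (carrier (H i))"
    and hom: "\<And>i. i \<in> I \<Longrightarrow> p i \<in> hom G (H i)"
    and cont: "\<And>i. i \<in> I \<Longrightarrow> continuous_map T (discrete_topology (carrier (H i))) (p i)"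
    and directed: "\<And>i j. i \<in> I \<Longrightarrow> j \<in> I \<Longrightarrow>
      \<exists>k\<in>I. \<forall>x\<in>carrier G. \<forall>y\<in>carrier G. p k x = p k y \<longrightarrow> p i x = p i y \<and> p j x = p j y"
    and separating: "\<And>x y. x \<in> carrier G \<Longrightarrow> y \<in> carrier G \<Longrightarrow> (\<And>i. i \<in> I \<Longrightarrow> p i x = p i y) \<Longrightarrow> x = y"
  shows "distributive (closed_subgroups G T) (closed_subgroup_join G T) (\<inter>)"
proof -
  have gh: "group_hom G (H i) (p i)" if "i \<in> I" for i
    using that H hom is_group by (simp add: group_hom_def group_hom_axioms_def)
  have closed_preimage: "closedin T {x \<in> carrier G. p i x \<in> V}" if i: "i \<in> I" for i V
  proof -
    have "closedin T {x \<in> topspace T. p i x \<in> V \<inter> carrier (H i)}"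
      by (rule closedin_continuous_map_preimage[OF cont[OF i]]) simp
    moreover have "{x \<in> topspace T. p i x \<in> V \<inter> carrier (H i)} = {x \<in> carrier G. p i x \<in> V}"
      using hom_carrier[OF hom[OF i]] by (auto simp: topspace_eq)
    ultimately show ?thesis by simp
  qed
  \<comment> \<open>The points of \<open>Y\<close> agreeing with \<open>w\<close> at level
    \<open>i\<close> form a closed nonempty set, and these sets are directed; a common point equals
    \<open>w\<close> because the \<open>p i\<close> separate points.\<close>
  have mem_closed: "w \<in> Y" if Y: "closedin T Y" and w: "w \<in> carrier G" "\<And>i. i \<in> I \<Longrightarrow> p i w \<in> p i ` Y" for w Y
  proof -
    have YG: "Y \<subseteq> carrier G" using closedin_subset[OF Y] by (simp add: topspace_eq)
    obtain y where y: "\<And>i. i \<in> I \<Longrightarrow> y \<in> Y \<inter> {x \<in> carrier G. p i x \<in> {p i w}}"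
    proof (rule compact_space_directed_Inter[OF compact I, of "\<lambda>i. Y \<inter> {x \<in> carrier G. p i x \<in> {p i w}}"])
      fix i assume i: "i \<in> I"
      show "closedin T (Y \<inter> {x \<in> carrier G. p i x \<in> {p i w}})"
        using Y closed_preimage[OF i] by (rule closedin_Int)
      show "Y \<inter> {x \<in> carrier G. p i x \<in> {p i w}} \<noteq> {}"
        using w(2)[OF i] YG by force
    next
      fix i j assume "i \<in> I" "j \<in> I"
      then obtain k where k: "k \<in> I"
        "\<forall>x\<in>carrier G. \<forall>y\<in>carrier G. p k x = p k y \<longrightarrow> p i x = p i y \<and> p j x = p j y"
        using directed by blast
      have "p i x = p i w \<and> p j x = p j w" if "x \<in> carrier G" "p k x = p k w" for x
        using k(2) w(1) that by blast
      then show "\<exists>k\<in>I. Y \<inter> {x \<in> carrier G. p k x \<in> {p k w}}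
          \<subseteq> (Y \<inter> {x \<in> carrier G. p i x \<in> {p i w}}) \<inter> (Y \<inter> {x \<in> carrier G. p j x \<in> {p j w}})"
        by (intro bexI[OF _ k(1)]) blast
    qed (use that in blast)
    have "y = w" using y I w(1) by (intro separating) auto
    then show ?thesis using y I by auto
  qed
  have "x \<in> closed_subgroup_join G T X (Y \<inter> Z)"
    if XYZ: "X \<in> closed_subgroups G T" "Y \<in> closed_subgroups G T" "Z \<in> closed_subgroups G T"
      and x: "x \<in> closed_subgroup_join G T X Y" "x \<in> closed_subgroup_join G T X Z" for X Y Z x
  proof -
    have sub: "subgroup X G" "subgroup Y G" "subgroup Z G" and cl: "closedin T X" "closedin T Y" "closedin T Z"
      using XYZ by (auto simp: closed_subgroups_def)
    have xG: "x \<in> carrier G"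
      using x(1) closure_of_subset_topspace[of T] by (auto simp: closed_subgroup_join_def topspace_eq)
    \<comment> \<open>The preimage of the image of the generated subgroup is closed, so it contains
      the closure too; in the abelian group \<open>H i\<close> that image lies in the product
      set.\<close>
    have join_image: "p i x \<in> p i ` X <#>\<^bsub>H i\<^esub> p i ` W"
      if i: "i \<in> I" and W: "subgroup W G" "x \<in> closed_subgroup_join G T X W" for i W
    proof -
      interpret pi: group_hom G "H i" "p i" by (rule gh[OF i])
      interpret Hi: comm_group "H i" using pi.H.cyclic_imp_abelian_group H(2)[OF i] by blast
      have XW: "X \<union> W \<subseteq> carrier G" using sub(1) W(1) by (auto dest: subgroup.mem_carrier)
      let ?J = "generate G (X \<union> W)"
      have "?J \<subseteq> {x \<in> carrier G. p i x \<in> p i ` ?J}" using generate_incl[OF XW] by auto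
      then have "x \<in> {x \<in> carrier G. p i x \<in> p i ` ?J}"
        using W(2) closure_of_minimal[OF _ closed_preimage[OF i]] unfolding closed_subgroup_join_def by blast
      moreover have "p i ` ?J = generate (H i) (p i ` X \<union> p i ` W)"
        using pi.generate_img[OF XW] by (simp add: image_Un)
      ultimately show ?thesis
        using Hi.generate_Un_subset_set_mult[of "p i ` X" "p i ` W"]
          pi.subgroup_img_is_subgroup[OF sub(1)] pi.subgroup_img_is_subgroup[OF W(1)] by auto
    qed
    \<comment> \<open>The intersection of the images may exceed the image of
      \<open>Y \<inter> Z\<close>. This is repaired in the limit, where \<open>mem_closed\<close> is
      applied to \<open>Y\<close> and \<open>Z\<close> separately.\<close>
    have image_mult: "\<exists>a\<in>X. p i (inv a \<otimes> x) \<in> p i ` Y \<inter> p i ` Z" if i: "i \<in> I" for i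
    proof -
      interpret pi: group_hom G "H i" "p i" by (rule gh[OF i])
      have "p i x \<in> p i ` X <#>\<^bsub>H i\<^esub> (p i ` Y \<inter> p i ` Z)"
        using pi.H.cyclic_set_mult_Int_distrib[OF H(2)[OF i] H(3)[OF i], of "p i ` X" "p i ` Y" "p i ` Z"]
          pi.subgroup_img_is_subgroup[OF sub(1)] pi.subgroup_img_is_subgroup[OF sub(2)] pi.subgroup_img_is_subgroup[OF sub(3)]
          join_image[OF i sub(2) x(1)] join_image[OF i sub(3) x(2)] by blast
      then obtain a v where a: "a \<in> X" and v: "v \<in> p i ` Y \<inter> p i ` Z" "p i x = p i a \<otimes>\<^bsub>H i\<^esub> v"
        by (auto simp: set_mult_def)
      have "a \<in> carrier G" "v \<in> carrier (H i)"
        using a v(1) sub by (auto dest: subgroup.mem_carrier)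
      then have "p i (inv a \<otimes> x) = v" using v(2) xG by (simp add: pi.H.m_assoc[symmetric])
      then show ?thesis using a v by auto
    qed
    \<comment> \<open>The elements \<open>a\<close> that work at level \<open>i\<close>: closed by
      continuity of \<open>inv a \<otimes> x\<close> in \<open>a\<close>, and shrinking when the
      level is refined.\<close>
    let ?D = "\<lambda>i. X \<inter> {a \<in> topspace T. inv a \<otimes> x \<in> {y \<in> carrier G. p i y \<in> p i ` Y \<inter> p i ` Z}}"
    obtain a where a: "\<And>i. i \<in> I \<Longrightarrow> a \<in> ?D i"
    proof (rule compact_space_directed_Inter[OF compact I, of ?D])
      fix i assume i: "i \<in> I"
      have "continuous_map T T (\<lambda>a. inv a \<otimes> x)"
        using xG continuous_inv by (intro continuous_map_group_mult) (auto simp: topspace_eq)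
      then show "closedin T (?D i)"
        by (rule closedin_Int[OF cl(1) closedin_continuous_map_preimage[OF _ closed_preimage[OF i]]])
      show "?D i \<noteq> {}"
      proof -
        obtain a where "a \<in> X" "p i (inv a \<otimes> x) \<in> p i ` Y \<inter> p i ` Z" using image_mult[OF i] by blast
        moreover have "a \<in> carrier G" using \<open>a \<in> X\<close> sub by (simp add: subgroup.mem_carrier)
        ultimately have "a \<in> ?D i" using xG by (simp add: topspace_eq)
        then show ?thesis by blast
      qed
    next
      fix i j assume ij: "i \<in> I" "j \<in> I"
      then obtain k where k: "k \<in> I"
        "\<forall>x\<in>carrier G. \<forall>y\<in>carrier G. p k x = p k y \<longrightarrow> p i x = p i y \<and> p j x = p j y"
        using directed by blast
      have "p i y \<in> p i ` W \<and> p j y \<in> p j ` W" if W: "subgroup W G" and y: "y \<in> carrier G" "p k y \<in> p k ` W" for y W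
      proof -
        obtain w where w: "w \<in> W" "p k y = p k w" using y by blast
        then have "w \<in> carrier G" using W by (simp add: subgroup.mem_carrier)
        then have "p i y = p i w" "p j y = p j w" using k(2) w(2) y(1) by blast+
        then show ?thesis using w by blast
      qed
      then show "\<exists>k\<in>I. ?D k \<subseteq> ?D i \<inter> ?D j"
        using sub by (intro bexI[OF _ k(1)]) blast
    qed (use that in blast)
    then have aX: "a \<in> X" using I by blast
    then have aG: "a \<in> carrier G" using sub by (simp add: subgroup.mem_carrier)
    have "inv a \<otimes> x \<in> Y \<inter> Z"
      using aG xG a by (intro IntI mem_closed[OF cl(2)] mem_closed[OF cl(3)]) auto
    then have "a \<otimes> (inv a \<otimes> x) \<in> generate G (X \<union> (Y \<inter> Z))"
      using aX by (intro mult_mem_generate_Un)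
    moreover have "a \<otimes> (inv a \<otimes> x) = x" using aG xG by (simp add: m_assoc[symmetric])
    moreover have "generate G (X \<union> (Y \<inter> Z)) \<subseteq> topspace T"
      unfolding topspace_eq using sub by (intro generate_incl) (auto dest: subgroup.mem_carrier)
    ultimately show ?thesis
      using closure_of_subset[of "generate G (X \<union> (Y \<inter> Z))" T] by (auto simp: closed_subgroup_join_def)
  qed
  moreover have "closed_subgroup_join G T X W \<subseteq> closed_subgroup_join G T X W'" if "W \<subseteq> W'" for X W W'
    unfolding closed_subgroup_join_def using that by (intro closure_of_mono mono_generate) auto
  ultimately show ?thesis
    unfolding distributive_def by (intro ballI equalityI subsetI IntI) (blast+)
qed

text \<open>The coordinates of the isomorphism serve as the maps \<open>p i\<close>. For an upper
  bound \<open>k\<close> of \<open>i\<close> and \<open>j\<close> the transition maps compute both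
  coordinates from the one at \<open>k\<close>, and injectivity of \<open>h\<close> separates
  points.\<close>

lemma procyclic_imp_distributive_closed:
  assumes "procyclic G T"
  shows "distributive (closed_subgroups G T) (closed_subgroup_join G T) (\<inter>)"
proof -
  obtain I :: "'a set set" and r and H :: "'a set \<Rightarrow> 'a set monoid" and \<phi> h
    where sys: "inverse_system I r H \<phi>" and fc: "\<forall>i\<in>I. finite (carrier (H i)) \<and> cyclic_group (H i)"
      and iso: "topological_group_iso G T (inverse_limit_group I r H \<phi>) (inverse_limit_topology I r H \<phi>) h"
    using assms unfolding procyclic_def by blast
  interpret inverse_system I r H \<phi> by (rule sys)
  have h_hom: "h \<in> hom G (inverse_limit_group I r H \<phi>)"
    and h_bij: "bij_betw h (carrier G) (inverse_limit_carrier I r H \<phi>)"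
    using iso by (auto simp: topological_group_iso_def iso_def inverse_limit_group_def)
  have h_lim: "h x \<in> inverse_limit_carrier I r H \<phi>" if "x \<in> carrier G" for x
    using h_bij that by (auto simp: bij_betw_def)
  have h_cont: "continuous_map T (product_topology (\<lambda>i. discrete_topology (carrier (H i))) I) h"
    using iso unfolding topological_group_iso_def inverse_limit_topology_def
    by (auto dest!: homeomorphic_imp_continuous_map simp: continuous_map_in_subtopology)
  show ?thesis
  proof (rule distributive_closed_if_cyclic_quotients[of I H "\<lambda>i x. h x i"])
    show "I \<noteq> {}" by (rule nonempty)
    fix i assume i: "i \<in> I"
    show "group (H i)" "cyclic_group (H i)" "finite (carrier (H i))" using i groups fc by auto
    show "(\<lambda>x. h x i) \<in> hom G (H i)"
    proof (rule homI)
      show "h x i \<in> carrier (H i)" if "x \<in> carrier G" for x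
        using h_lim[OF that] i by (auto simp: inverse_limit_carrier_def PiE_iff)
      show "h (x \<otimes> y) i = h x i \<otimes>\<^bsub>H i\<^esub> h y i" if "x \<in> carrier G" "y \<in> carrier G" for x y
        using hom_mult[OF h_hom that] i by (simp add: inverse_limit_group_def)
    qed
    show "continuous_map T (discrete_topology (carrier (H i))) (\<lambda>x. h x i)"
      using h_cont i by (auto simp: continuous_map_componentwise)
  next
    fix i j assume ij: "i \<in> I" "j \<in> I"
    obtain k where k: "k \<in> I" "(i, k) \<in> r" "(j, k) \<in> r" using directed[OF ij] by blast
    have "h x i = \<phi> i k (h x k)" "h x j = \<phi> j k (h x k)" if "x \<in> carrier G" for x
      using h_lim[OF that] k by (auto simp: inverse_limit_carrier_def)
    then show "\<exists>k\<in>I. \<forall>x\<in>carrier G. \<forall>y\<in>carrier G. h x k = h y k \<longrightarrow> h x i = h y i \<and> h x j = h y j"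
      using k(1) by (intro bexI[of _ k]) auto
  next
    fix x y assume xy: "x \<in> carrier G" "y \<in> carrier G" "\<And>i. i \<in> I \<Longrightarrow> h x i = h y i"
    have "h x = h y"
      using h_lim[OF xy(1)] h_lim[OF xy(2)] xy(3)
      by (auto simp: inverse_limit_carrier_def intro: PiE_ext)
    then show "x = y" using h_bij xy(1,2) by (auto simp: bij_betw_def inj_on_def)
  qed
qed

end

theorem theorem3p1:
  fixes G :: "('a, 'c) monoid_scheme" and T :: "'a topology"
  assumes "profinite_group G T"
  shows "(distributive (closed_subgroups G T) (closed_subgroup_join G T) (\<inter>)
            \<longleftrightarrow> distributive (open_subgroups G T) (subgroup_join G) (\<inter>))
       \<and> (distributive (open_subgroups G T) (subgroup_join G) (\<inter>) \<longleftrightarrow> procyclic G T)"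
proof -
  interpret profinite_group G T by (rule assms)
  have "procyclic G T" if D: "distributive (open_subgroups G T) (subgroup_join G) (\<inter>)"
  proof (rule procyclic_if_open_quotients_cyclic)
    fix N assume N: "N \<lhd> G" "openin T N"
    show "cyclic_group (G Mod N)"
      using normal.factorgroup_is_group[OF N(1)] finite_open_quotient[OF N] distributive_quotient[OF D N]
      by (rule group.finite_distributive_imp_cyclic)
  qed
  \<comment> \<open>This closes the cycle from open subgroups through procyclicity and closed
    subgroups back to open ones.\<close>
  then show ?thesis
    using distributive_open_if_closed procyclic_imp_distributive_closed by blast
qed

end
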